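(* Let $N\in\mathbb{N}$, let $y(0)=(y_1(0),\dots,y_N(0))\in\mathbb{C}^N$ have pairwise distinct components with $y_k(0)\neq 0$ for every $k=1,\dots,N$, let $\zeta_1,\dots,\zeta_N\in\mathbb{R}$, let $\xi\in\mathbb{R}\setminus\{0\}$, and set $\xi_1=-\frac13\xi$, $\xi_2=\xi_3=\frac23\xi$. Then there exist $T>0$ and a solution $(z,y):(0,T)\to\mathbb{C}^3\times\mathbb{C}^N$ of the system $$\dot{\bar z}_j=\frac1{2\pi i}\sum_{\ell\in\{1,2,3\},\,\ell\neq j}\frac{\xi_\ell}{z_j-z_\ell}+\frac1{2\pi i}\sum_{h=1}^N\frac{\zeta_h}{z_j-y_h},\qquad j=1,2,3,$$ $$\dot{\bar y}_k=\frac1{2\pi i}\sum_{\ell=1}^3\frac{\xi_\ell}{y_k-z_\ell}+\frac1{2\pi i}\sum_{h\in\{1,\dots,N\},\,h\neq k}\frac{\zeta_h}{y_k-y_h},\qquad k=1,\dots,N,$$ such that $\lim_{t\to0}z_j(t)=0$ for $j=1,2,3$ and $\lim_{t\to0}y_k(t)=y_k(0)$ for $k=1,\dots,N$.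
   Context: A bar denotes complex conjugation and a dot the derivative in time. A solution on $(0,T)$ is a $C^1$ curve along which the $N+3$ points $z_1(t),z_2(t),z_3(t),y_1(t),\dots,y_N(t)$ are pairwise distinct for every $t\in(0,T)$ (so that all denominators are nonzero) and which satisfies the equations at every $t\in(0,T)$. *)

theory Defs
  imports "HOL-Analysis.Analysis"
begin

(* C^3 and C^N are represented by families indexed by {1..3} and {1..N}; the values of
   xi, z, zeta, y at other indices are irrelevant. *)
definition vortex_solution ::
  "nat \<Rightarrow> (nat \<Rightarrow> real) \<Rightarrow> (nat \<Rightarrow> real) \<Rightarrow> real \<Rightarrow> (nat \<Rightarrow> real \<Rightarrow> complex) \<Rightarrow> (nat \<Rightarrow> real \<Rightarrow> complex) \<Rightarrow> bool"
where
  "vortex_solution N \<xi> \<zeta> T z y \<longleftrightarrow>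
     (\<forall>j\<in>{1..3}. z j C1_differentiable_on {0<..<T}) \<and>
     (\<forall>k\<in>{1..N}. y k C1_differentiable_on {0<..<T}) \<and>
     (\<forall>t\<in>{0<..<T}.
        inj_on (\<lambda>j. z j t) {1..3} \<and>
        inj_on (\<lambda>k. y k t) {1..N} \<and>
        (\<forall>j\<in>{1..3}. \<forall>k\<in>{1..N}. z j t \<noteq> y k t) \<and>
        (\<forall>j\<in>{1..3}.
           ((\<lambda>s. cnj (z j s)) has_vector_derivative
              1 / (2 * of_real pi * \<i>) * (\<Sum>l\<in>{1..3} - {j}. of_real (\<xi> l) / (z j t - z l t))
            + 1 / (2 * of_real pi * \<i>) * (\<Sum>h\<in>{1..N}. of_real (\<zeta> h) / (z j t - y h t))) (at t)) \<and>
        (\<forall>k\<in>{1..N}.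
           ((\<lambda>s. cnj (y k s)) has_vector_derivative
              1 / (2 * of_real pi * \<i>) * (\<Sum>l\<in>{1..3}. of_real (\<xi> l) / (y k t - z l t))
            + 1 / (2 * of_real pi * \<i>) * (\<Sum>h\<in>{1..N} - {k}. of_real (\<zeta> h) / (y k t - y h t))) (at t)))"

end

theory Submission
  imports Defs "HOL-Probability.Discrete_Topology"
begin

text \<open>
  Write \<open>z\<^sub>1 = m + v\<close>, \<open>z\<^sub>2 = m + u\<close>, \<open>z\<^sub>3 = m - u\<close>. Without the background vortices
  \<open>cnj v * v' = cnj P\<close> and \<open>cnj u * u' = cnj P / 3\<close>, where \<open>P = c q\<^sup>2 / (q\<^sup>2 - 1)\<close> with \<open>q = v / u\<close>,
  \<open>c = \<xi> / (2 \<pi> \<i>)\<close>. Hence \<open>\<bar>v\<bar>\<^sup>2 - 3 \<bar>u\<bar>\<^sup>2\<close> is conserved, and where it vanishes \<open>q\<close> is constant and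
  \<open>\<bar>u\<bar>\<^sup>2 = \<kappa> t\<close> with \<open>\<kappa> = 2 Re P / 3\<close>: a self-similar spiral burst as soon as \<open>Re P > 0\<close>, for instance for
  \<open>q\<^sup>2 = - 3 \<i> sgn \<xi>\<close>.

  The background enters the relative coordinates only through differences of a smooth field, and
  in the unknowns \<open>\<bar>v\<bar>\<^sup>2 - 3 \<bar>u\<bar>\<^sup>2\<close>, \<open>arg q\<close>, \<open>\<bar>u\<bar>\<^sup>2\<close>, \<open>arg u\<close>, \<open>m - v / 3\<close>, \<open>y\<close> the singular terms are triangular.
  Giving each unknown a slightly smaller power of \<open>t\<close> than it really has makes the perturbation
  equations (with \<open>t = s ^ 4\<close>) of the form \<open>(s ^ k w)' = s ^ k H\<close> with \<open>H\<close> bounded and Lipschitz in \<open>w\<close>, which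
  the contraction principle solves from \<open>s = 0\<close>.
\<close>

section \<open>Uniformly Lipschitz right-hand sides\<close>

definition adm :: "real \<Rightarrow> real \<Rightarrow> real \<Rightarrow> (nat \<Rightarrow> complex) \<Rightarrow> bool" where
  "adm S \<delta> s w \<longleftrightarrow> 0 < s \<and> s \<le> S \<and> (\<forall>j. norm (w j) \<le> \<delta>)"

text \<open>No limit as \<open>s \<rightarrow> 0\<close> is required below: the equations oscillate through \<open>cis (4 * \<omega> * ln s)\<close>.\<close>
definition tame_bound :: "real \<Rightarrow> real \<Rightarrow> real \<Rightarrow> (real \<Rightarrow> (nat \<Rightarrow> complex) \<Rightarrow> 'a::real_normed_vector) \<Rightarrow> bool" where
  "tame_bound S \<delta> C f \<longleftrightarrow> C \<ge> 0 \<and> (\<forall>s w. adm S \<delta> s w \<longrightarrow> norm (f s w) \<le> C) \<and>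
     (\<forall>s w w' d. adm S \<delta> s w \<longrightarrow> adm S \<delta> s w' \<longrightarrow> (\<forall>j. norm (w j - w' j) \<le> d) \<longrightarrow>
        norm (f s w - f s w') \<le> C * d)"

text \<open>Continuity is asked along continuous curves: the integral operator only ever substitutes
  a candidate curve, and this form passes through compositions without fixing a topology on the
  sequences \<open>w\<close>.\<close>

definition tame :: "real \<Rightarrow> real \<Rightarrow> (real \<Rightarrow> (nat \<Rightarrow> complex) \<Rightarrow> 'a::real_normed_vector) \<Rightarrow> bool" where
  "tame S \<delta> f \<longleftrightarrow> (\<exists>C. tame_bound S \<delta> C f) \<and>
     (\<forall>w. (\<forall>j. continuous_on {0<..S} (w j)) \<longrightarrow> (\<forall>j s. norm (w j s) \<le> \<delta>) \<longrightarrow>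
        continuous_on {0<..S} (\<lambda>s. f s (\<lambda>j. w j s)))"

lemma tame_boundD:
  assumes "tame_bound S \<delta> C f"
  shows "C \<ge> 0" "\<And>s w. adm S \<delta> s w \<Longrightarrow> norm (f s w) \<le> C"
    "\<And>s w w' d. adm S \<delta> s w \<Longrightarrow> adm S \<delta> s w' \<Longrightarrow> (\<And>j. norm (w j - w' j) \<le> d) \<Longrightarrow>
       norm (f s w - f s w') \<le> C * d"
  using assms unfolding tame_bound_def by blast+

lemma tame_boundE:
  assumes "tame S \<delta> f"
  obtains C where "tame_bound S \<delta> C f"
  using assms unfolding tame_def by blast

lemma tameI:
  assumes "\<And>s w. adm S \<delta> s w \<Longrightarrow> norm (f s w) \<le> C"
    and "\<And>s w w' d. adm S \<delta> s w \<Longrightarrow> adm S \<delta> s w' \<Longrightarrow> (\<And>j. norm (w j - w' j) \<le> d) \<Longrightarrow> 0 \<le> d \<Longrightarrow>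
           norm (f s w - f s w') \<le> D * d"
    and cont: "\<And>w. (\<And>j. continuous_on {0<..S} (w j)) \<Longrightarrow> (\<And>j s. norm (w j s) \<le> \<delta>) \<Longrightarrow>
        continuous_on {0<..S} (\<lambda>s. f s (\<lambda>j. w j s))"
  shows "tame S \<delta> f"
proof -
  define B where "B = \<bar>C\<bar> + \<bar>D\<bar>"
  have "norm (f s w) \<le> B" if "adm S \<delta> s w" for s w
    using assms(1)[OF that] by (simp add: B_def)
  moreover have "norm (f s w - f s w') \<le> B * d"
    if "adm S \<delta> s w" "adm S \<delta> s w'" "\<forall>j. norm (w j - w' j) \<le> d" for s w w' d
  proof -
    have d: "0 \<le> d" using that(3) norm_ge_zero order_trans by blast
    have "D * d \<le> B * d" by (rule mult_right_mono[OF _ d]) (simp add: B_def)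
    with assms(2)[OF that(1,2) that(3)[rule_format] d] show ?thesis by linarith
  qed
  moreover have "0 \<le> B" by (simp add: B_def)
  ultimately show ?thesis unfolding tame_def tame_bound_def using cont by blast
qed

lemma tame_continuous_on:
  assumes "tame S \<delta> f" "\<And>j. continuous_on {0<..S} (w j)" "\<And>j s. norm (w j s) \<le> \<delta>"
  shows "continuous_on {0<..S} (\<lambda>s. f s (\<lambda>j. w j s))"
  using assms unfolding tame_def by blast

section \<open>Closure of tame functions under algebra and Lipschitz maps\<close>

lemma tame_time:
  assumes "continuous_on {0<..S} g" "\<And>s. 0 < s \<Longrightarrow> s \<le> S \<Longrightarrow> norm (g s) \<le> C"
  shows "tame S \<delta> (\<lambda>s w. g s)"
  by (rule tameI[where C = C and D = 0]) (use assms in \<open>auto simp: adm_def\<close>)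

lemma tame_const: "tame S \<delta> (\<lambda>s w. a)"
  by (rule tame_time[where C = "norm a"]) auto

lemma tame_power: "tame S \<delta> (\<lambda>s w. s ^ n)"
  by (rule tame_time[where C = "S ^ n"]) (auto intro!: continuous_intros power_mono)

lemma tame_id: "tame S \<delta> (\<lambda>s w. s)"
  using tame_power[where n = 1] by simp

lemma tame_proj: "tame S \<delta> (\<lambda>s w. w i)"
  by (rule tameI[where C = \<delta> and D = 1]) (auto simp: adm_def)

lemma tame_lipschitz:
  assumes f: "tame S \<delta> f" and h: "L-lipschitz_on A h"
    and A: "\<And>s w. adm S \<delta> s w \<Longrightarrow> f s w \<in> A"
  shows "tame S \<delta> (\<lambda>s w. h (f s w))"
proof (cases "A = {}")
  \<comment> \<open>With \<open>A\<close> empty no pair is admissible. A curve bounded by \<delta>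
    would give an admissible pair at each point of \<open>{0<..S}\<close>, so that interval is empty
    and continuity is vacuous.\<close>
  case True
  with A have no: "\<not> adm S \<delta> s w" for s w by blast
  have "continuous_on {0<..S} (\<lambda>s. h (f s (\<lambda>j. w j s)))"
    if w: "\<And>j s. norm (w j s) \<le> \<delta>" for w
  proof -
    have "{0<..S} = {}"
    proof (rule equals0I)
      fix s assume "s \<in> {0<..S}"
      then have "adm S \<delta> s (\<lambda>j. w j s)" using w by (simp add: adm_def)
      with no show False by blast
    qed
    then show ?thesis by (simp only: continuous_on_empty)
  qed
  then show ?thesis using no by (intro tameI) auto
next
  case False
  then obtain a where a: "a \<in> A" by blast
  obtain C where "tame_bound S \<delta> C f" using f by (rule tame_boundE)
  note C = tame_boundD[OF this]
  have Lh: "norm (h x - h y) \<le> L * norm (x - y)" if "x \<in> A" "y \<in> A" for x y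
    using h that by (auto simp: lipschitz_on_def dist_norm)
  have L0: "L \<ge> 0" using h by (simp add: lipschitz_on_def)
  show ?thesis
  proof (rule tameI)
    fix s w assume *: "adm S \<delta> s w"
    have "norm (h (f s w)) \<le> norm (h a) + norm (h (f s w) - h a)"
      by (metis add.commute diff_add_cancel norm_triangle_ineq)
    also have "norm (h (f s w) - h a) \<le> L * norm (f s w - a)" by (rule Lh) (use A * a in auto)
    also have "\<dots> \<le> L * (C + norm a)"
      using C(2)[OF *] norm_triangle_ineq4[of "f s w" a] by (intro mult_left_mono L0) linarith
    finally show "norm (h (f s w)) \<le> norm (h a) + L * (C + norm a)" by simp
  next
    fix s w w' d assume *: "adm S \<delta> s w" "adm S \<delta> s w'" "\<And>j. norm (w j - w' j) \<le> d"
    have "norm (h (f s w) - h (f s w')) \<le> L * norm (f s w - f s w')"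
      by (rule Lh) (use A * in auto)
    also have "\<dots> \<le> L * (C * d)" by (intro mult_left_mono L0 C(3) *)
    finally show "norm (h (f s w) - h (f s w')) \<le> (L * C) * d" by simp
  next
    fix w :: "nat \<Rightarrow> real \<Rightarrow> complex"
    assume *: "\<And>j. continuous_on {0<..S} (w j)" "\<And>j s. norm (w j s) \<le> \<delta>"
    show "continuous_on {0<..S} (\<lambda>s. h (f s (\<lambda>j. w j s)))"
      by (rule continuous_on_compose2[OF lipschitz_on_continuous_on[OF h] tame_continuous_on[OF f *]])
        (use * in \<open>auto intro!: A simp: adm_def\<close>)
  qed
qed

lemma tame_bounded_linear:
  assumes "tame S \<delta> f" "bounded_linear h"
  shows "tame S \<delta> (\<lambda>s w. h (f s w))"
proof -
  obtain L where "L-lipschitz_on UNIV h"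
    using bounded_linear.lipschitz_boundE[OF assms(2)] by metis
  from tame_lipschitz[OF assms(1) this] show ?thesis by simp
qed

lemmas tame_Re = tame_bounded_linear[OF _ bounded_linear_Re]
  and tame_Im = tame_bounded_linear[OF _ bounded_linear_Im]
  and tame_cnj = tame_bounded_linear[OF _ bounded_linear_cnj]
  and tame_of_real = tame_bounded_linear[OF _ bounded_linear_of_real]
  and tame_minus = tame_bounded_linear[OF _ bounded_linear_minus[OF bounded_linear_ident]]

lemma tame_add:
  assumes f: "tame S \<delta> f" and g: "tame S \<delta> g"
  shows "tame S \<delta> (\<lambda>s w. f s w + g s w)"
proof -
  obtain C where "tame_bound S \<delta> C f" using f by (rule tame_boundE)
  note C = tame_boundD[OF this]
  obtain D where "tame_bound S \<delta> D g" using g by (rule tame_boundE)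
  note D = tame_boundD[OF this]
  show ?thesis
  proof (rule tameI)
    show "norm (f s w + g s w) \<le> C + D" if "adm S \<delta> s w" for s w
      by (rule norm_triangle_mono) (use that C D in auto)
    show "norm (f s w + g s w - (f s w' + g s w')) \<le> (C + D) * d"
      if "adm S \<delta> s w" "adm S \<delta> s w'" "\<And>j. norm (w j - w' j) \<le> d" for s w w' d
      using norm_triangle_mono[OF C(3)[OF that] D(3)[OF that]] by (simp add: algebra_simps)
    show "continuous_on {0<..S} (\<lambda>s. f s (\<lambda>j. w j s) + g s (\<lambda>j. w j s))"
      if "\<And>j. continuous_on {0<..S} (w j)" "\<And>j s. norm (w j s) \<le> \<delta>" for w
      by (intro continuous_intros tame_continuous_on[OF f] tame_continuous_on[OF g] that)
  qed
qed

lemma tame_diff: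
  assumes f: "tame S \<delta> f" and g: "tame S \<delta> g"
  shows "tame S \<delta> (\<lambda>s w. f s w - g s w)"
proof -
  have "(\<lambda>s w. f s w - g s w) = (\<lambda>s w. f s w + - g s w)" by simp
  then show ?thesis using tame_add[OF f tame_minus[OF g]] by simp
qed

lemma tame_sum:
  assumes "\<And>i. i \<in> I \<Longrightarrow> tame S \<delta> (f i)"
  shows "tame S \<delta> (\<lambda>s w. \<Sum>i\<in>I. f i s w)"
proof (cases "finite I")
  case True
  then show ?thesis using assms
  proof (induction I)
    case (insert i I)
    have "tame S \<delta> (\<lambda>s w. f i s w + (\<Sum>i\<in>I. f i s w))"
      by (rule tame_add) (use insert in auto)
    then show ?case using insert.hyps by simp
  qed (simp add: tame_const)
qed (simp add: tame_const)

lemma tame_mult: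
  fixes f g :: "real \<Rightarrow> (nat \<Rightarrow> complex) \<Rightarrow> 'a::real_normed_algebra"
  assumes f: "tame S \<delta> f" and g: "tame S \<delta> g"
  shows "tame S \<delta> (\<lambda>s w. f s w * g s w)"
proof -
  obtain C where "tame_bound S \<delta> C f" using f by (rule tame_boundE)
  note C = tame_boundD[OF this]
  obtain D where "tame_bound S \<delta> D g" using g by (rule tame_boundE)
  note D = tame_boundD[OF this]
  show ?thesis
  proof (rule tameI)
    show "norm (f s w * g s w) \<le> C * D" if "adm S \<delta> s w" for s w
      by (rule order_trans[OF norm_mult_ineq mult_mono]) (use that C D in auto)
    show "norm (f s w * g s w - f s w' * g s w') \<le> (2 * C * D) * d"
      if *: "adm S \<delta> s w" "adm S \<delta> s w'" "\<And>j. norm (w j - w' j) \<le> d" "0 \<le> d" for s w w' d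
    proof -
      have "f s w * g s w - f s w' * g s w' = (f s w - f s w') * g s w + f s w' * (g s w - g s w')"
        by (simp add: algebra_simps)
      also have "norm \<dots> \<le> (C * d) * D + C * (D * d)"
        by (intro norm_triangle_mono order_trans[OF norm_mult_ineq] mult_mono C D *) (use C D * in auto)
      finally show ?thesis by (simp add: algebra_simps)
    qed
    show "continuous_on {0<..S} (\<lambda>s. f s (\<lambda>j. w j s) * g s (\<lambda>j. w j s))"
      if "\<And>j. continuous_on {0<..S} (w j)" "\<And>j s. norm (w j s) \<le> \<delta>" for w
      by (intro continuous_intros tame_continuous_on[OF f] tame_continuous_on[OF g] that)
  qed
qed

lemma tame_if:
  assumes "b \<Longrightarrow> tame S \<delta> f" "\<not> b \<Longrightarrow> tame S \<delta> g"
  shows "tame S \<delta> (\<lambda>s w. if b then f s w else g s w)"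
  using assms by (cases b) simp_all

lemma tame_inverse:
  fixes f :: "real \<Rightarrow> (nat \<Rightarrow> complex) \<Rightarrow> 'a::real_normed_field"
  assumes f: "tame S \<delta> f" and e: "e > 0" "\<And>s w. adm S \<delta> s w \<Longrightarrow> e \<le> norm (f s w)"
  shows "tame S \<delta> (\<lambda>s w. inverse (f s w))"
proof (rule tame_lipschitz[OF f])
  show "(1 / (e * e))-lipschitz_on {x. e \<le> norm x} (inverse :: 'a \<Rightarrow> 'a)"
  proof (rule lipschitz_onI)
    fix x y :: 'a assume "x \<in> {x. e \<le> norm x}" "y \<in> {x. e \<le> norm x}"
    then have xy: "e \<le> norm x" "e \<le> norm y" by auto
    with e have nz: "x \<noteq> 0" "y \<noteq> 0" by auto
    have "norm (inverse x - inverse y) = norm (x - y) / (norm x * norm y)"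
      using nz by (simp add: inverse_diff_inverse norm_mult norm_inverse divide_inverse)
    also have "\<dots> \<le> norm (x - y) / (e * e)"
      by (rule divide_left_mono) (use xy e in \<open>auto intro!: mult_mono mult_pos_pos\<close>)
    finally show "dist (inverse x) (inverse y) \<le> 1 / (e * e) * dist x y" by (simp add: dist_norm)
  qed (use e in auto)
qed (use e in auto)

lemma tame_divide:
  fixes f g :: "real \<Rightarrow> (nat \<Rightarrow> complex) \<Rightarrow> 'a::real_normed_field"
  assumes "tame S \<delta> f" "tame S \<delta> g" "e > 0" "\<And>s w. adm S \<delta> s w \<Longrightarrow> e \<le> norm (g s w)"
  shows "tame S \<delta> (\<lambda>s w. f s w / g s w)"
  using tame_mult[OF assms(1) tame_inverse[OF assms(2,3,4)]] by (simp add: divide_inverse)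

lemma tame_sqrt:
  assumes f: "tame S \<delta> f" and e: "e > 0" "\<And>s w. adm S \<delta> s w \<Longrightarrow> e \<le> f s w"
  shows "tame S \<delta> (\<lambda>s w. sqrt (f s w))"
proof (rule tame_lipschitz[OF f])
  show "(1 / sqrt e)-lipschitz_on {e..} sqrt"
  proof (rule lipschitz_onI)
    fix x y :: real assume "x \<in> {e..}" "y \<in> {e..}"
    then have xy: "e \<le> x" "e \<le> y" by auto
    have le: "sqrt e \<le> sqrt x + sqrt y" using xy e by (smt (verit) real_sqrt_ge_zero real_sqrt_le_mono)
    have "(sqrt x - sqrt y) * (sqrt x + sqrt y) = x - y"
      using xy e by (simp add: algebra_simps)
    then have "\<bar>sqrt x - sqrt y\<bar> * \<bar>sqrt x + sqrt y\<bar> = \<bar>x - y\<bar>" by (metis abs_mult)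
    moreover have "\<bar>sqrt x - sqrt y\<bar> * sqrt e \<le> \<bar>sqrt x - sqrt y\<bar> * \<bar>sqrt x + sqrt y\<bar>"
      using le by (intro mult_left_mono) auto
    ultimately show "dist (sqrt x) (sqrt y) \<le> 1 / sqrt e * dist x y"
      using e by (simp add: dist_norm field_simps)
  qed (use e in auto)
qed (use e in auto)

text \<open>Mean value inequality for \<open>exp\<close> along the imaginary axis, a convex set on
  which \<open>exp\<close> has modulus 1.\<close>

lemma cis_lipschitz: "norm (cis x - cis y) \<le> \<bar>x - y\<bar>"
proof -
  have "cis x - cis y = exp (\<i> * of_real x) - exp (\<i> * of_real y)"
    by (simp add: cis_conv_exp)
  also have "norm \<dots> \<le> 1 * norm (\<i> * of_real x - \<i> * complex_of_real y)"
  proof (rule field_differentiable_bound[where S = "{z. Re z = 0}" and f' = exp])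
    have "convex {z::complex. \<i> \<bullet> (\<i> * z) = 0}" 
      by (rule convexI) (auto simp: inner_complex_def scaleR_conv_of_real)
    moreover have "{z. \<i> \<bullet> (\<i> * z) = 0} = {z. Re z = 0}" by (auto simp: inner_complex_def)
    ultimately show "convex {z. Re z = 0}" by simp
    show "(exp has_field_derivative exp z) (at z within {z. Re z = 0})" for z :: complex
      by (rule DERIV_exp[THEN has_field_derivative_at_within])
  qed auto
  also have "\<dots> = \<bar>x - y\<bar>"
    by (simp flip: right_diff_distrib of_real_diff add: norm_mult)
  finally show ?thesis .
qed

text \<open>The phase \<open>g\<close> may be unbounded near 0, as a logarithm is: once the
  exponential is split, it enters only through a factor of modulus 1 that does not depend on
  \<open>w\<close>.\<close>

lemma tame_cis:
  assumes f: "tame S \<delta> f" and g: "continuous_on {0<..S} g"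
  shows "tame S \<delta> (\<lambda>s w. cis (g s + f s w))"
proof -
  have "tame S \<delta> (\<lambda>s w. cis (g s))"
    by (rule tame_time[where C = 1]) (use g in \<open>auto intro!: continuous_intros\<close>)
  moreover have "tame S \<delta> (\<lambda>s w. cis (f s w))"
    by (rule tame_lipschitz[OF f, where L = 1 and A = UNIV])
      (auto simp: lipschitz_on_def dist_norm cis_lipschitz)
  ultimately have "tame S \<delta> (\<lambda>s w. cis (g s) * cis (f s w))" by (rule tame_mult)
  then show ?thesis by (simp add: cis_mult)
qed

text \<open>Dividing by \<open>s\<^sup>2\<close> costs nothing: \<open>cis\<close> is 1-Lipschitz,
  so the quotient is 1-Lipschitz in the value of \<open>f\<close>, uniformly in \<open>s\<close>,
  and vanishes where that value is 0.\<close>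

lemma tame_cis_quotient:
  assumes f: "tame S \<delta> f"
  shows "tame S \<delta> (\<lambda>s w. (1 - cis (s\<^sup>2 * f s w)) / of_real (s\<^sup>2))"
proof -
  obtain C where "tame_bound S \<delta> C f" using f by (rule tame_boundE)
  note C = tame_boundD[OF this]
  have *: "norm ((1 - cis (s\<^sup>2 * x)) / complex_of_real (s\<^sup>2) - (1 - cis (s\<^sup>2 * y)) / of_real (s\<^sup>2)) \<le> \<bar>x - y\<bar>"
    if s: "0 < s" for s x y :: real
  proof -
    have "norm ((1 - cis (s\<^sup>2 * x)) / complex_of_real (s\<^sup>2) - (1 - cis (s\<^sup>2 * y)) / of_real (s\<^sup>2))
       = norm (cis (s\<^sup>2 * y) - cis (s\<^sup>2 * x)) / s\<^sup>2"
      by (simp flip: diff_divide_distrib add: norm_divide norm_power)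
    also have "\<dots> \<le> \<bar>s\<^sup>2 * y - s\<^sup>2 * x\<bar> / s\<^sup>2"
      by (intro divide_right_mono cis_lipschitz) auto
    also have "\<dots> = \<bar>x - y\<bar>"
      using s by (simp flip: right_diff_distrib add: abs_mult abs_minus_commute)
    finally show ?thesis .
  qed
  show ?thesis
  proof (rule tameI)
    show "norm ((1 - cis (s\<^sup>2 * f s w)) / complex_of_real (s\<^sup>2)) \<le> C" if "adm S \<delta> s w" for s w
      using *[of s "f s w" 0] C(2)[OF that] that by (simp add: adm_def)
    show "norm ((1 - cis (s\<^sup>2 * f s w)) / complex_of_real (s\<^sup>2) - (1 - cis (s\<^sup>2 * f s w')) / of_real (s\<^sup>2)) \<le> C * d"
      if "adm S \<delta> s w" "adm S \<delta> s w'" "\<And>j. norm (w j - w' j) \<le> d" for s w w' d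
      using *[of s "f s w" "f s w'"] C(3)[OF that] that(1) by (simp add: adm_def)
    show "continuous_on {0<..S} (\<lambda>s. (1 - cis (s\<^sup>2 * f s (\<lambda>j. w j s))) / complex_of_real (s\<^sup>2))"
      if "\<And>j. continuous_on {0<..S} (w j)" "\<And>j s. norm (w j s) \<le> \<delta>" for w
      by (intro continuous_intros tame_continuous_on[OF f] that) auto
  qed
qed

text \<open>The integrand may oscillate at 0, so integrability comes from measurability and
  boundedness on the half-open interval; the added endpoint is a null set.\<close>

lemma integrable_on_bounded_continuous:
  fixes \<phi> :: "real \<Rightarrow> complex"
  assumes c: "continuous_on {0<..S} \<phi>" and b: "\<And>s. 0 < s \<Longrightarrow> s \<le> S \<Longrightarrow> norm (\<phi> s) \<le> M"
  shows "\<phi> integrable_on {0..S}"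
proof -
  have meas: "{0<..S} \<in> sets lebesgue" by simp
  have "\<phi> integrable_on {0<..S}"
  proof (rule measurable_bounded_by_integrable_imp_integrable[where g = "\<lambda>_. M"])
    show "\<phi> \<in> borel_measurable (lebesgue_on {0<..S})"
      by (rule continuous_imp_measurable_on_sets_lebesgue[OF c meas])
    show "(\<lambda>_. M) integrable_on {0<..S}"
      by (intro integrable_on_const bounded_set_imp_lmeasurable bounded_subset[OF bounded_closed_interval[of 0 S]])
        auto
  qed (use b in auto)
  then show ?thesis
    by (rule integrable_spike_set)
      (auto intro: negligible_subset[of "{0}"])
qed

section \<open>Singular systems of differential equations\<close>

lemma tame_bound_mono:
  assumes "tame_bound S \<delta> C f" "C \<le> C'"
  shows "tame_bound S \<delta> C' f"
proof -
  have "norm (f s w - f s w') \<le> C' * d"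
    if "adm S \<delta> s w" "adm S \<delta> s w'" "\<forall>j. norm (w j - w' j) \<le> d" for s w w' d
  proof -
    have "0 \<le> d" using that(3) norm_ge_zero order_trans by blast
    then have "C * d \<le> C' * d" using assms(2) by (intro mult_right_mono)
    with tame_boundD(3)[OF assms(1) that(1,2)] that(3) show ?thesis by (meson order_trans)
  qed
  moreover have "norm (f s w) \<le> C'" if "adm S \<delta> s w" for s w
    using tame_boundD(2)[OF assms(1) that] assms(2) by linarith
  ultimately show ?thesis
    using tame_boundD(1)[OF assms(1)] assms(2) unfolding tame_bound_def by (blast intro: order_trans)
qed

text \<open>Each slice \<open>{i} \<times> UNIV\<close> is open, because points of a discrete space
  are; hence continuity can be checked slice by slice.\<close>

lemma continuous_on_discrete_prod:
  fixes g :: "'a discrete \<times> 'b::topological_space \<Rightarrow> 'c::topological_space"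
  assumes "\<And>i. continuous_on UNIV (\<lambda>s. g (i, s))"
  shows "continuous_on UNIV g"
proof -
  have "continuous_on (\<Union>i. {i} \<times> UNIV) g"
  proof (rule continuous_on_open_UN)
    fix i :: "'a discrete"
    show "open ({i} \<times> (UNIV :: 'b set))" by (intro open_Times open_discrete open_UNIV)
    have "continuous_on ({i} \<times> UNIV) (\<lambda>p. g (i, snd p))"
      by (rule continuous_on_compose2[OF assms]) (auto intro: continuous_intros)
    then show "continuous_on ({i} \<times> UNIV) g"
      by (rule continuous_on_eq) auto
  qed
  moreover have "(\<Union>i::'a discrete. {i} \<times> (UNIV :: 'b set)) = UNIV" by auto
  ultimately show ?thesis by simp
qed

text \<open>The equations \<open>w\<^sub>i' + (k\<^sub>i / s) w\<^sub>i = H\<^sub>i\<close> are integrated from \<open>0\<close>: the Volterra operator gains a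
  factor \<open>s\<close>, so it contracts for small times without any spectral condition. The index set is
  made a metric space (\<open>discrete\<close>) because bounded continuous functions are known to be complete only
  over metric domains.\<close>
lemma singular_system_solution:
  fixes H :: "nat \<Rightarrow> real \<Rightarrow> (nat \<Rightarrow> complex) \<Rightarrow> complex" and k :: "nat \<Rightarrow> nat"
  assumes S0: "S0 > 0" and \<delta>: "\<delta> > 0"
    and tame: "\<And>i. i < n \<Longrightarrow> tame S0 \<delta> (H i)"
    and zero: "\<forall>i\<ge>n. \<forall>s w. H i s w = 0"
  shows "\<exists>S w. 0 < S \<and> S \<le> S0 \<and> (\<forall>i s. norm (w i s) \<le> \<delta>) \<and>
    (\<forall>i. (w i \<longlongrightarrow> 0) (at_right 0)) \<and>
    (\<forall>i s. 0 < s \<longrightarrow> s < S \<longrightarrow>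
      ((\<lambda>s. of_real (s ^ k i) * w i s) has_vector_derivative
         of_real (s ^ k i) * H i s (\<lambda>j. w j s)) (at s))"
proof -
  have "\<forall>i. \<exists>C. i < n \<longrightarrow> tame_bound S0 \<delta> C (H i)"
    using tame by (meson tame_boundE)
  then obtain Cf where Cf: "\<And>i. i < n \<Longrightarrow> tame_bound S0 \<delta> (Cf i) (H i)" by metis
  \<comment> \<open>One constant for all components; the summand 1 makes it at least 1, so that it
    can be divided by.\<close>
  define C where "C = 1 + (\<Sum>i<n. Cf i)"
  have Cf0: "0 \<le> Cf i" if "i < n" for i using tame_boundD(1)[OF Cf[OF that]] .
  have C1: "C \<ge> 1" using Cf0 by (auto simp: C_def intro: sum_nonneg)
  have tb: "tame_bound S0 \<delta> C (H i)" for i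
  proof (cases "i < n")
    case True
    have "Cf i \<le> (\<Sum>i<n. Cf i)" by (rule member_le_sum) (use True Cf0 in auto)
    then show ?thesis by (intro tame_bound_mono[OF Cf[OF True]]) (simp add: C_def)
  next
    case False
    have "0 \<le> C * d" if "\<forall>j. norm (w j - w' j) \<le> d" for d and w w' :: "nat \<Rightarrow> complex"
      using that C1 norm_ge_zero order_trans by (metis mult_nonneg_nonneg zero_le_one)
    then show ?thesis using False C1 by (auto simp: tame_bound_def zero)
  qed
  have tm: "tame S0 \<delta> (H i)" for i
  proof (cases "i < n")
    case False
    then have "H i = (\<lambda>s w. 0)" using zero by (intro ext) simp
    then show ?thesis by (simp add: tame_const)
  qed (rule tame)
  \<comment> \<open>\<open>C * S \<le> \<delta>\<close> will keep the operator inside the ball, and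
    \<open>C * S \<le> 1/2\<close> makes it a contraction.\<close>
  define S where "S = min S0 (min (\<delta> / C) (1 / (2 * C)))"
  have S: "0 < S" "S \<le> S0" "C * S \<le> \<delta>" "C * S \<le> 1/2"
  proof -
    show "0 < S" "S \<le> S0" using S0 \<delta> C1 by (auto simp: S_def)
    have "S \<le> \<delta> / C" "S \<le> 1 / (2 * C)" by (auto simp: S_def)
    then show "C * S \<le> \<delta>" "C * S \<le> 1/2" using C1 by (auto simp: field_simps)
  qed
  \<comment> \<open>The right-hand side is controlled at positive times only; the default 0 at
    \<sigma> = 0 does not affect the integrals over \<open>{0..s}\<close>.\<close>
  define \<psi> where "\<psi> f i \<sigma> = (if \<sigma> \<le> 0 then 0 else of_real (\<sigma> ^ k i) * H i \<sigma> (\<lambda>j. f (discrete j, \<sigma>)))"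
    for f :: "nat discrete \<times> real \<Rightarrow> complex" and i \<sigma>
  define J where "J f i s = integral {0..s} (\<psi> f i)" for f i s
  define Q where "Q f i s = J f i s / of_real (s ^ k i)" for f i s
  \<comment> \<open>Clamping the time to \<open>{0..S}\<close> extends the integrated curve to a
    bounded continuous function on the whole line.\<close>
  define G where "G f = (\<lambda>(i, s). Q f (of_discrete i) (max 0 (min s S)))" for f
  define X where "X = {f :: nat discrete \<times> real \<Rightarrow> complex. continuous_on UNIV f \<and> (\<forall>x. norm (f x) \<le> \<delta>)}"
  have adm: "adm S0 \<delta> \<sigma> (\<lambda>j. f (discrete j, \<sigma>))" if "f \<in> X" "0 < \<sigma>" "\<sigma> \<le> S" for f \<sigma>
    using that S by (auto simp: adm_def X_def)
  have \<psi>cont: "continuous_on {0<..S} (\<psi> f i)" if f: "f \<in> X" for f i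
  proof -
    have cf: "continuous_on {0<..S0} (\<lambda>s. f (discrete j, s))" for j
      by (rule continuous_on_compose2[of UNIV f]) (use f in \<open>auto simp: X_def intro!: continuous_intros\<close>)
    have "continuous_on {0<..S} (\<lambda>s. of_real (s ^ k i) * H i s (\<lambda>j. f (discrete j, s)))"
      by (intro continuous_intros continuous_on_subset[OF tame_continuous_on[OF tm]] cf)
        (use f S in \<open>auto simp: X_def\<close>)
    then show ?thesis by (rule continuous_on_eq) (auto simp: \<psi>_def)
  qed
  have \<psi>b: "norm (\<psi> f i \<sigma>) \<le> s ^ k i * C" if "f \<in> X" "0 \<le> \<sigma>" "\<sigma> \<le> s" "s \<le> S" for f i \<sigma> s
  proof (cases "\<sigma> = 0")
    case True then show ?thesis using that C1 by (auto simp: \<psi>_def)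
  next
    case False
    then have "norm (\<psi> f i \<sigma>) = \<sigma> ^ k i * norm (H i \<sigma> (\<lambda>j. f (discrete j, \<sigma>)))"
      using that by (auto simp: \<psi>_def norm_mult norm_power)
    also have "\<dots> \<le> s ^ k i * C"
      using that False by (intro mult_mono power_mono tame_boundD(2)[OF tb] adm) auto
    finally show ?thesis .
  qed
  have \<psi>i: "\<psi> f i integrable_on {0..s}" if "f \<in> X" "s \<le> S" for f i s
  proof (rule integrable_on_bounded_continuous[where M = "s ^ k i * C"])
    show "continuous_on {0<..s} (\<psi> f i)"
      by (rule continuous_on_subset[OF \<psi>cont[OF that(1)]]) (use that in auto)
  qed (use \<psi>b[OF that(1)] that in auto)
  have ib: "norm (integral {0..s} h) \<le> s * M"
    if "0 \<le> s" "h integrable_on {0..s}" "\<And>\<sigma>. 0 \<le> \<sigma> \<Longrightarrow> \<sigma> \<le> s \<Longrightarrow> norm (h \<sigma>) \<le> M" for h :: "real \<Rightarrow> complex" and s M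
  proof -
    have "norm (integral {0..s} h) \<le> integral {0..s} (\<lambda>_. M)"
      by (rule integral_norm_bound_integral) (use that in auto)
    then show ?thesis using that(1) by simp
  qed
  \<comment> \<open>The weight at times up to \<open>s\<close> is at most \<open>s ^ k i\<close>,
    which the division cancels; the length of the interval supplies the remaining factor
    \<open>s\<close>.\<close>
  have Qb: "norm (Q f i s) \<le> C * s" if "f \<in> X" "0 \<le> s" "s \<le> S" for f i s
  proof (cases "s = 0")
    case True then show ?thesis by (simp add: Q_def J_def)
  next
    case False
    have "norm (J f i s) \<le> s * (s ^ k i * C)"
      unfolding J_def by (rule ib) (use that \<psi>b \<psi>i in auto)
    then show ?thesis using that False
      by (simp add: Q_def norm_divide norm_power divide_simps mult_ac)
  qed
  have Qd: "norm (Q f i s - Q g i s) \<le> C * s * d"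
    if fg: "f \<in> X" "g \<in> X" "0 \<le> s" "s \<le> S" "\<And>x. norm (f x - g x) \<le> d" for f g i s d
  proof (cases "s = 0")
    case True then show ?thesis by (simp add: Q_def J_def)
  next
    case False
    have d0: "0 \<le> d" using that(5) norm_ge_zero order_trans by blast
    have "norm (integral {0..s} (\<lambda>\<sigma>. \<psi> f i \<sigma> - \<psi> g i \<sigma>)) \<le> s * (s ^ k i * (C * d))"
    proof (rule ib)
      show "norm (\<psi> f i \<sigma> - \<psi> g i \<sigma>) \<le> s ^ k i * (C * d)" if \<sigma>: "0 \<le> \<sigma>" "\<sigma> \<le> s" for \<sigma>
      proof (cases "\<sigma> = 0")
        case True then show ?thesis using d0 C1 \<open>0 \<le> s\<close> by (auto simp: \<psi>_def)
      next
        case False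
        then have "norm (\<psi> f i \<sigma> - \<psi> g i \<sigma>) = \<sigma> ^ k i * norm (H i \<sigma> (\<lambda>j. f (discrete j, \<sigma>)) - H i \<sigma> (\<lambda>j. g (discrete j, \<sigma>)))"
          using \<sigma> by (auto simp: \<psi>_def norm_mult norm_power simp flip: right_diff_distrib)
        also have "\<dots> \<le> s ^ k i * (C * d)"
          using \<sigma> False fg C1 d0
          by (intro mult_mono power_mono tame_boundD(3)[OF tb] adm) auto
        finally show ?thesis .
      qed
    qed (use that in \<open>auto intro!: integrable_diff \<psi>i\<close>)
    also have "integral {0..s} (\<lambda>\<sigma>. \<psi> f i \<sigma> - \<psi> g i \<sigma>) = J f i s - J g i s"
      unfolding J_def by (rule integral_diff) (use that \<psi>i in auto)
    finally show ?thesis using that False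
      by (simp add: Q_def norm_divide norm_power divide_simps mult_ac flip: diff_divide_distrib)
  qed
  \<comment> \<open>At 0 continuity comes from the bound \<open>C * s\<close>, since the formula
    itself reads 0 / 0 there when \<open>k i > 0\<close>.\<close>
  have Qc: "continuous_on {0..S} (Q f i)" if f: "f \<in> X" for f i
    unfolding continuous_on_eq_continuous_within
  proof
    fix s assume s: "s \<in> {0..S}"
    show "continuous (at s within {0..S}) (Q f i)"
    proof (cases "s = 0")
      case True
      have "((\<lambda>s. C * s) \<longlongrightarrow> C * 0) (at 0 within {0..S})" by (intro tendsto_intros)
      then have lim: "((\<lambda>s. C * s) \<longlongrightarrow> 0) (at 0 within {0..S})" by simp
      have "\<forall>\<^sub>F s in at 0 within {0..S}. norm (Q f i s) \<le> C * s"
        unfolding eventually_at_filter by (rule always_eventually) (auto intro: Qb[OF f])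
      then have "(Q f i \<longlongrightarrow> 0) (at 0 within {0..S})"
        by (rule Lim_null_comparison[OF _ lim])
      then show ?thesis using True by (simp add: continuous_within Q_def J_def)
    next
      case False
      have "continuous_on {0..S} (J f i)"
        unfolding J_def by (rule indefinite_integral_continuous_1[OF \<psi>i[OF f]]) simp
      then have "continuous (at s within {0..S}) (J f i)"
        using s by (simp add: continuous_on_eq_continuous_within)
      then show ?thesis unfolding Q_def
        by (intro continuous_intros) (use False in auto)
    qed
  qed
  have GX: "G f \<in> X" if f: "f \<in> X" for f
  proof -
    have "continuous_on UNIV (G f)"
    proof (rule continuous_on_discrete_prod)
      show "continuous_on UNIV (\<lambda>s. G f (i, s))" for i
        unfolding G_def prod.case
        by (rule continuous_on_compose2[OF Qc[OF f]]) (use S in \<open>auto intro!: continuous_intros\<close>)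
    qed
    moreover have "norm (G f (i, s)) \<le> \<delta>" for i s
    proof -
      have "norm (G f (i, s)) \<le> C * max 0 (min s S)"
        unfolding G_def prod.case by (rule Qb[OF f]) (use S in auto)
      also have "\<dots> \<le> C * S" using C1 S by (intro mult_left_mono) auto
      finally show ?thesis using S by simp
    qed
    ultimately show ?thesis by (auto simp: X_def)
  qed
  have XB: "f \<in> bcontfun" if "f \<in> X" for f
    using that unfolding X_def by (blast intro: bcontfun_normI)
  define \<Phi> where "\<Phi> F = Bcontfun (G (apply_bcontfun F))" for F
  define Y where "Y = cball (0 :: (nat discrete \<times> real) \<Rightarrow>\<^sub>C complex) \<delta>"
  have YX: "apply_bcontfun F \<in> X" if "F \<in> Y" for F
  proof -
    have "norm F \<le> \<delta>" using that by (simp add: Y_def)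
    then have "norm (F x) \<le> \<delta>" for x using norm_bounded[of F x] by linarith
    then show ?thesis unfolding X_def by simp
  qed
  have app: "apply_bcontfun (\<Phi> F) = G (apply_bcontfun F)" if "F \<in> Y" for F
    unfolding \<Phi>_def by (rule Bcontfun_inverse[OF XB[OF GX[OF YX[OF that]]]])
  have "\<exists>!F\<in>Y. \<Phi> F = F"
  proof (rule Banach_fix[where c = "1/2"])
    show "complete Y" unfolding Y_def complete_eq_closed by (rule closed_cball)
    show "Y \<noteq> {}" using \<delta> by (simp add: Y_def)
    show "\<Phi> ` Y \<subseteq> Y"
    proof safe
      fix F assume F: "F \<in> Y"
      have "norm (G F x) \<le> \<delta>" for x using GX[OF YX[OF F]] unfolding X_def by blast
      then have "norm (\<Phi> F) \<le> \<delta>" by (intro norm_bound) (simp add: app[OF F])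
      then show "\<Phi> F \<in> Y" by (simp add: Y_def)
    qed
    show "dist (\<Phi> F) (\<Phi> F') \<le> 1/2 * dist F F'" if F: "F \<in> Y" "F' \<in> Y" for F F'
    proof (rule dist_bound)
      fix x :: "nat discrete \<times> real"
      obtain i s where x: "x = (i, s)" by force
      let ?r = "max 0 (min s S)"
      have "dist (\<Phi> F x) (\<Phi> F' x) = norm (Q F (of_discrete i) ?r - Q F' (of_discrete i) ?r)"
        by (simp add: app F G_def x dist_norm)
      also have "\<dots> \<le> C * ?r * dist F F'"
      proof (intro Qd YX F)
        show "norm (F x - F' x) \<le> dist F F'" for x using dist_bounded[of F x F'] by (simp add: dist_norm)
      qed (use S in auto)
      also have "\<dots> \<le> 1/2 * dist F F'"
      proof (rule mult_right_mono)
        have "C * ?r \<le> C * S" using C1 S by (intro mult_left_mono) auto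
        then show "C * ?r \<le> 1/2" using S by linarith
      qed simp
      finally show "dist (\<Phi> F x) (\<Phi> F' x) \<le> 1/2 * dist F F'" .
    qed
  qed auto
  then obtain F where F: "F \<in> Y" "\<Phi> F = F" by blast
  have FX: "apply_bcontfun F \<in> X" by (rule YX[OF F(1)])
  define w where "w i s = F (discrete i, s)" for i s
  have wQ: "w i s = Q F i s" if "0 \<le> s" "s \<le> S" for i s
  proof -
    have "w i s = G F (discrete i, s)" unfolding w_def using app[OF F(1)] F(2) by simp
    then show ?thesis using that by (simp add: G_def discrete_inverse)
  qed
  show ?thesis
  proof (intro exI[of _ S] exI[of _ w] conjI allI impI S(1,2))
    show "norm (w i s) \<le> \<delta>" for i s using FX unfolding w_def X_def by blast
    show "(w i \<longlongrightarrow> 0) (at_right 0)" for i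
    proof (rule Lim_null_comparison[where g = "\<lambda>s. C * s"])
      have "((\<lambda>s. C * s) \<longlongrightarrow> C * 0) (at_right 0)" by (intro tendsto_intros)
      then show "((\<lambda>s. C * s) \<longlongrightarrow> 0) (at_right 0)" by simp
      show "\<forall>\<^sub>F s in at_right 0. norm (w i s) \<le> C * s"
        by (rule eventually_at_rightI[OF _ S(1)]) (auto simp: wQ intro!: Qb[OF FX])
    qed
    fix i s assume s: "0 < s" "s < S"
    \<comment> \<open>At positive times the integrand is continuous, so the fundamental theorem of
      calculus turns the fixed point equation back into the differential equation.\<close>
    have "((\<lambda>u. integral {0..u} (\<psi> F i)) has_vector_derivative \<psi> F i s) (at s within {0..S} - {})"
    proof (rule integral_has_vector_derivative_continuous_at)
      have "continuous (at s) (\<psi> F i)"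
        using continuous_on_interior[OF \<psi>cont[OF FX], of s] s by simp
      then show "continuous (at s within {0..S} - {}) (\<psi> F i)" by (rule continuous_at_imp_continuous_at_within)
    qed (use \<psi>i[OF FX] s in auto)
    then have "(J F i has_vector_derivative \<psi> F i s) (at s)"
      using s at_within_Icc_at[of 0 s S] unfolding J_def by simp
    then have "((\<lambda>s. of_real (s ^ k i) * w i s) has_vector_derivative \<psi> F i s) (at s)"
    proof (rule has_vector_derivative_transform_within_open[where S = "{0<..<S}"])
      show "J F i s = of_real (s ^ k i) * w i s" if "s \<in> {0<..<S}" for s
        using that by (simp add: wQ Q_def)
    qed (use s in auto)
    then show "((\<lambda>s. of_real (s ^ k i) * w i s) has_vector_derivative
         of_real (s ^ k i) * H i s (\<lambda>j. w j s)) (at s)"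
      using s by (simp add: \<psi>_def w_def)
  qed
qed

section \<open>Perturbation of the self-similar burst\<close>

text \<open>In polar form the equation cnj u * u' = B splits into r' = 2 Re B for r =
  \<bar>u\<bar>^2 and \<theta>' = Im B / r for the argument; \<open>q\<close> is a fixed
  rotation.\<close>

lemma polar_has_vector_derivative:
  fixes r \<theta> :: "real \<Rightarrow> real" and B q :: complex
  assumes r: "(r has_real_derivative 2 * Re B) (at s)"
    and \<theta>: "(\<theta> has_real_derivative Im B / r s) (at s)"
    and pos: "r s > 0" and q: "norm q = 1"
  shows "((\<lambda>s. q * of_real (sqrt (r s)) * cis (\<theta> s)) has_vector_derivative
           B / cnj (q * of_real (sqrt (r s)) * cis (\<theta> s))) (at s)"
proof -
  let ?u = "q * of_real (sqrt (r s)) * cis (\<theta> s)"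
  have sq: "((\<lambda>s. sqrt (r s)) has_real_derivative Re B / sqrt (r s)) (at s)"
    using r pos by (auto intro!: derivative_eq_intros simp: field_simps)
  have c: "((\<lambda>s. cis (\<theta> s)) has_vector_derivative (Im B / r s) *\<^sub>R (\<i> * cis (\<theta> s))) (at s)"
  proof -
    have "(cis has_vector_derivative \<i> * cis x) (at x)" for x
      by (auto simp: has_vector_derivative_complex_iff intro!: derivative_eq_intros)
    from vector_diff_chain_at[OF \<theta>[unfolded has_real_derivative_iff_has_vector_derivative] this]
    show ?thesis by (simp add: o_def)
  qed
  have sqc: "((\<lambda>s. complex_of_real (sqrt (r s))) has_vector_derivative of_real (Re B / sqrt (r s))) (at s)"
    using sq by (rule has_vector_derivative_of_real)
  have "((\<lambda>s. q * (of_real (sqrt (r s)) * cis (\<theta> s))) has_vector_derivative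
      q * (of_real (sqrt (r s)) * ((Im B / r s) *\<^sub>R (\<i> * cis (\<theta> s))) + of_real (Re B / sqrt (r s)) * cis (\<theta> s))) (at s)"
    by (intro has_vector_derivative_mult_right has_vector_derivative_mult sqc c)
  moreover have "q * (of_real (sqrt (r s)) * ((Im B / r s) *\<^sub>R (\<i> * cis (\<theta> s))) + of_real (Re B / sqrt (r s)) * cis (\<theta> s))
     = B / cnj ?u"
  proof -
    have nz: "?u \<noteq> 0" using pos q by auto
    have rs: "complex_of_real (sqrt (r s)) * of_real (sqrt (r s)) = of_real (r s)"
      using pos by (simp flip: of_real_mult)
    have "norm ?u = sqrt (r s)" using pos q by (simp add: norm_mult)
    then have "?u * cnj ?u = of_real (r s)" using pos by (simp only: complex_norm_square[symmetric]) simp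
    then have "B / cnj ?u = B * ?u / of_real (r s)" using nz pos by (simp add: field_simps)
    also have "\<dots> = (of_real (Re B) + \<i> * of_real (Im B)) * ?u / of_real (r s)"
      by (simp flip: complex_eq)
    finally have B: "B / cnj ?u = (of_real (Re B) + \<i> * of_real (Im B)) * ?u / of_real (r s)" .
    have alg: "q * (m * (b / (m * m) * (\<i> * c)) + a / m * c) = (a + \<i> * b) * (q * m * c) / (m * m)"
      if "m \<noteq> 0" for m a b c :: complex
      using that by (simp add: field_simps)
    show ?thesis
      unfolding B using alg[of "of_real (sqrt (r s))" "of_real (Im B)" "cis (\<theta> s)" "of_real (Re B)"] pos rs
      by (simp add: scaleR_conv_of_real)
  qed
  ultimately show ?thesis by (simp add: mult.assoc)
qed

text \<open>Under t = s ^ 4 the factor \<open>4 * s ^ 3\<close> is dt/ds and cancels in the chain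
  rule.\<close>

lemma has_vector_derivative_fourth_root:
  fixes f :: "real \<Rightarrow> complex"
  assumes t: "t > 0" and f: "(f has_vector_derivative of_real (4 * s ^ 3) * D) (at s)"
    and s: "s = t powr (1/4)"
  shows "((\<lambda>t. f (t powr (1/4))) has_vector_derivative D) (at t)"
proof -
  have "s ^ 3 = t powr (3/4)" using t unfolding s by (simp add: powr_power)
  moreover have "((\<lambda>t. t powr (1/4)) has_vector_derivative (1/4) * t powr (- (3/4))) (at t)"
    using t by (auto simp flip: has_real_derivative_iff_has_vector_derivative intro!: derivative_eq_intros)
  from vector_diff_chain_at[OF this] f
  have "((\<lambda>t. f (t powr (1/4))) has_vector_derivative ((1/4) * t powr (- (3/4))) *\<^sub>R (of_real (4 * s ^ 3) * D)) (at t)"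
    by (simp add: o_def s)
  moreover have "((1/4) * t powr (- (3/4))) *\<^sub>R (of_real (4 * s ^ 3) * D) = D"
  proof -
    have "((1/4) * t powr (- (3/4))) * (4 * s ^ 3) = 1"
      using t by (simp add: \<open>s ^ 3 = _\<close> powr_add[symmetric])
    then have "complex_of_real ((1/4) * t powr (- (3/4))) * of_real (4 * s ^ 3) = 1"
      by (simp only: of_real_mult[symmetric] of_real_1)
    then show ?thesis by (simp only: scaleR_conv_of_real mult.assoc[symmetric] mult_1_left)
  qed
  ultimately show ?thesis by simp
qed

lemma filterlim_fourth_root: "filterlim (\<lambda>t::real. t powr (1/4)) (at_right 0) (at_right 0)"
proof (rule tendsto_imp_filterlim_at_right)
  show "((\<lambda>t::real. t powr (1/4)) \<longlongrightarrow> 0) (at_right 0)"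
  proof (rule tendsto_zero_powrI)
    show "\<forall>\<^sub>F t in at_right 0. (0::real) \<le> t" by (rule eventually_at_rightI[of 0 1]) auto
  qed (auto intro!: tendsto_eq_intros)
  show "\<forall>\<^sub>F t in at_right 0. 0 < (t::real) powr (1/4)" by (rule eventually_at_rightI[of 0 1]) auto
qed

text \<open>Here \<open>V - U\<close>, \<open>V + U\<close> and \<open>2 * U\<close> are z1 - z2, z1
  - z3 and z2 - z3. With \<open>A = k * V / (V\<^sup>2 - U\<^sup>2)\<close> and
  \<open>B = k * V\<^sup>2 / (V\<^sup>2 - U\<^sup>2) / (3 * U)\<close> the conjugate velocities of
  the triple are 4/3 A, A/3 + B and A/3 - B, so those of m, v and u are A/3, A and B.\<close>

lemma pair_interaction:
  fixes U V k :: complex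
  assumes "V\<^sup>2 - U\<^sup>2 \<noteq> 0" "U \<noteq> 0"
  shows "k * (2/3 / (V - U) + 2/3 / (V + U)) = 4/3 * (k * V / (V\<^sup>2 - U\<^sup>2))"
    and "k * (- 1/3 / (U - V) + 2/3 / (2 * U)) = k * V / (V\<^sup>2 - U\<^sup>2) / 3 + k * V\<^sup>2 / (V\<^sup>2 - U\<^sup>2) / (3 * U)"
    and "k * (- 1/3 / (- U - V) + 2/3 / (- 2 * U)) = k * V / (V\<^sup>2 - U\<^sup>2) / 3 - k * V\<^sup>2 / (V\<^sup>2 - U\<^sup>2) / (3 * U)"
proof -
  define a b where ab: "a = V - U" "b = V + U"
  have UV: "V = (a + b) / 2" "U = (b - a) / 2" by (simp_all add: ab)
  have f: "V\<^sup>2 - U\<^sup>2 = a * b" by (simp add: ab power2_eq_square algebra_simps)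
  have d: "U - V = - a" "- U - V = - b" "V - U = a" "V + U = b" "2 * U = b - a" "- 2 * U = - (b - a)"
    by (simp_all add: ab)
  have nz: "a \<noteq> 0" "b \<noteq> 0" "b - a \<noteq> 0" using assms(1)[unfolded f] assms(2) UV(2) by auto
  show "k * (2/3 / (V - U) + 2/3 / (V + U)) = 4/3 * (k * V / (V\<^sup>2 - U\<^sup>2))"
    unfolding f d unfolding UV(1) using nz by (simp add: field_simps)
  have "3 * U = 3 / 2 * (b - a)" by (simp add: UV(2))
  note d = d this
  show "k * (- 1/3 / (U - V) + 2/3 / (2 * U)) = k * V / (V\<^sup>2 - U\<^sup>2) / 3 + k * V\<^sup>2 / (V\<^sup>2 - U\<^sup>2) / (3 * U)"
    unfolding f d unfolding UV(1) using nz by (simp add: divide_simps) (simp add: algebra_simps power2_eq_square)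
  show "k * (- 1/3 / (- U - V) + 2/3 / (- 2 * U)) = k * V / (V\<^sup>2 - U\<^sup>2) / 3 - k * V\<^sup>2 / (V\<^sup>2 - U\<^sup>2) / (3 * U)"
    unfolding f d unfolding UV(1) using nz by (simp add: divide_simps) (simp add: algebra_simps power2_eq_square)
qed

text \<open>On the self-similar solution v / u is sqrt 3 times \<open>p\<close>, so its square is
  \<open>3 * e\<close> and \<open>P0\<close> is the value of P; the strength \<xi> is kept outside
  \<open>c\<close>. The conditions on \<open>P0\<close> express \<bar>u\<bar>^2 = \<kappa> t and arg
  u = \<omega> ln t. The radius \<mu> bounds the scaled state, and separation by
  \<open>4 * \<mu>\<close> leaves room for a triple within \<open>2 * \<mu>\<close> of the origin
  and for displacements of the background up to \<mu>.\<close>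

locale vortex_burst =
  fixes N :: nat and y0 :: "nat \<Rightarrow> complex" and \<zeta> :: "nat \<Rightarrow> real" and \<xi> :: real
    and c e p P0 :: complex and \<kappa> \<omega> \<mu> S :: real
  assumes p: "norm p = 1" "p\<^sup>2 = e" and e: "3 * e \<noteq> 1"
    and P0: "P0 = 3 * of_real \<xi> * c * e / (3 * e - 1)"
    and \<kappa>: "0 < \<kappa>" "Re P0 = 3 * \<kappa> / 2" and \<omega>: "Im P0 = - 3 * \<kappa> * \<omega>"
    and \<mu>: "0 < \<mu>" and S: "0 < S" "S \<le> 1" "S * \<mu> \<le> \<kappa> / 2" "S * (3 * sqrt (5 * \<kappa>)) \<le> \<mu>"
    and y0: "\<And>k. k \<in> {1..N} \<Longrightarrow> 4 * \<mu> \<le> norm (y0 k)"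
    and y0_diff: "\<And>k h. k \<in> {1..N} \<Longrightarrow> h \<in> {1..N} \<Longrightarrow> k \<noteq> h \<Longrightarrow> 4 * \<mu> \<le> norm (y0 k - y0 h)"
begin

text \<open>With \<open>t = s ^ 4\<close>, the scaled state \<open>w\<close> encodes \<open>\<bar>u\<bar>\<^sup>2 = s ^ 4 * rh\<close>, \<open>\<bar>v\<bar>\<^sup>2 = s ^ 4 * Rh\<close>, hence
  \<open>\<bar>v\<bar>\<^sup>2 - 3 \<bar>u\<bar>\<^sup>2 = s ^ 7 * Re (w 0)\<close>; \<open>s\<^sup>2 * Re (w 1)\<close> is the deviation of \<open>arg (v / u)\<close>, \<open>Re (w 3)\<close> that of
  \<open>arg u\<close>, \<open>w 4 = m - v / 3\<close> is the centre of vorticity of the triple and \<open>w (k + 4)\<close> the displacement of \<open>y\<^sub>k\<close>.\<close>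
definition rh :: "real \<Rightarrow> (nat \<Rightarrow> complex) \<Rightarrow> real" where
  "rh s w = \<kappa> + s * Re (w 2)"

definition Rh :: "real \<Rightarrow> (nat \<Rightarrow> complex) \<Rightarrow> real" where
  "Rh s w = 3 * rh s w + s ^ 3 * Re (w 0)"

definition uh :: "real \<Rightarrow> (nat \<Rightarrow> complex) \<Rightarrow> complex" where
  "uh s w = of_real (sqrt (rh s w)) * cis (4 * \<omega> * ln s + Re (w 3))"

definition vh :: "real \<Rightarrow> (nat \<Rightarrow> complex) \<Rightarrow> complex" where
  "vh s w = p * of_real (sqrt (Rh s w)) * cis (4 * \<omega> * ln s + (Re (w 3) + s\<^sup>2 * Re (w 1)))"

text \<open>\<open>Xh\<close> and \<open>Dh\<close> are \<open>vh\<^sup>2\<close> and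
  \<open>vh\<^sup>2 - uh\<^sup>2\<close> with their common oscillating phase divided out. The
  summand 0 is the phase \<open>g\<close> of \<open>tame_cis\<close>.\<close>

definition Xh :: "real \<Rightarrow> (nat \<Rightarrow> complex) \<Rightarrow> complex" where
  "Xh s w = e * of_real (Rh s w) * cis (0 + s\<^sup>2 * (2 * Re (w 1)))"

definition Dh :: "real \<Rightarrow> (nat \<Rightarrow> complex) \<Rightarrow> complex" where
  "Dh s w = Xh s w - of_real (rh s w)"

definition P :: "real \<Rightarrow> (nat \<Rightarrow> complex) \<Rightarrow> complex" where
  "P s w = of_real \<xi> * c * Xh s w / Dh s w"

text \<open>\<open>Ph = (P - P0) / s\<^sup>2\<close>, in a form that stays bounded as \<open>s \<rightarrow> 0\<close>; see \<open>P_eq\<close>.\<close>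
definition Ph :: "real \<Rightarrow> (nat \<Rightarrow> complex) \<Rightarrow> complex" where
  "Ph s w = of_real \<xi> * c * e / (3 * e - 1) *
     (3 * of_real (rh s w) * ((1 - cis (s\<^sup>2 * (2 * Re (w 1)))) / of_real (s\<^sup>2))
        - of_real (s * Re (w 0)) * cis (0 + s\<^sup>2 * (2 * Re (w 1)))) / Dh s w"

definition mm :: "real \<Rightarrow> (nat \<Rightarrow> complex) \<Rightarrow> complex" where
  "mm s w = of_real (s\<^sup>2 / 3) * vh s w + w 4"

definition zz :: "nat \<Rightarrow> real \<Rightarrow> (nat \<Rightarrow> complex) \<Rightarrow> complex" where
  "zz j s w = mm s w + of_real (s\<^sup>2) * (if j = 1 then vh s w else if j = 2 then uh s w else - uh s w)"

definition yy :: "nat \<Rightarrow> real \<Rightarrow> (nat \<Rightarrow> complex) \<Rightarrow> complex" where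
  "yy k s w = y0 k + w (k + 4)"

definition iz :: "nat \<Rightarrow> nat \<Rightarrow> real \<Rightarrow> (nat \<Rightarrow> complex) \<Rightarrow> complex" where
  "iz j h s w = 1 / (zz j s w - yy h s w)"

text \<open>If \<open>G\<^sub>j\<close> is the background velocity at the \<open>j\<close>-th vortex, then \<open>s\<^sup>2 gu = (G\<^sub>2 - G\<^sub>3) / 2\<close>,
  \<open>gm = (G\<^sub>2 + G\<^sub>3) / 2\<close> and \<open>s\<^sup>2 gv = G\<^sub>1 - gm\<close>; see \<open>background\<close>.\<close>
definition gu :: "real \<Rightarrow> (nat \<Rightarrow> complex) \<Rightarrow> complex" where
  "gu s w = cnj (c * (\<Sum>h\<in>{1..N}. of_real (\<zeta> h) * (- uh s w * iz 2 h s w * iz 3 h s w)))"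

definition gv :: "real \<Rightarrow> (nat \<Rightarrow> complex) \<Rightarrow> complex" where
  "gv s w = cnj (c * (\<Sum>h\<in>{1..N}. of_real (\<zeta> h) *
     (1/2 * ((uh s w - vh s w) * iz 1 h s w * iz 2 h s w - (uh s w + vh s w) * iz 1 h s w * iz 3 h s w))))"

definition gm :: "real \<Rightarrow> (nat \<Rightarrow> complex) \<Rightarrow> complex" where
  "gm s w = cnj (c * (\<Sum>h\<in>{1..N}. of_real (\<zeta> h) * (1/2 * (iz 2 h s w + iz 3 h s w))))"

section \<open>Right-hand sides of the scaled equations\<close>

definition H0 :: "real \<Rightarrow> (nat \<Rightarrow> complex) \<Rightarrow> real" where
  "H0 s w = 8 * (Re (cnj (vh s w) * gv s w) - 3 * Re (cnj (uh s w) * gu s w))"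

text \<open>The self-interaction in arg v - arg u is proportional to 1 / (3 rh) - 1 / Rh, which is
  \<open>s ^ 3 * Re (w 0)\<close> over 3 rh Rh. This absorbs the singular factor 1 / s and leaves
  the weight \<open>s\<^sup>2\<close>.\<close>

definition H1 :: "real \<Rightarrow> (nat \<Rightarrow> complex) \<Rightarrow> real" where
  "H1 s w = 4/3 * Im (P s w) * Re (w 0) / rh s w / Rh s w
     + 4 * s * (Im (cnj (vh s w) * gv s w) / Rh s w - Im (cnj (uh s w) * gu s w) / rh s w)"

text \<open>The part 3 \<kappa> / 2 of Re P accounts for the growth \<kappa> s ^ 4 of
  \<bar>u\<bar>^2, so only \<open>Ph\<close> and the background remain.\<close>

definition H2 :: "real \<Rightarrow> (nat \<Rightarrow> complex) \<Rightarrow> real" where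
  "H2 s w = 8/3 * Re (Ph s w) + 8 * s\<^sup>2 * Re (cnj (uh s w) * gu s w)"

text \<open>The rate 4 \<omega> / s of the logarithmic rotation cancels the contribution of Im P0,
  up to the term in \<open>Re (w 2)\<close> that comes from \<open>rh\<close> differing from
  \<kappa>.\<close>

definition H3 :: "real \<Rightarrow> (nat \<Rightarrow> complex) \<Rightarrow> real" where
  "H3 s w = - (4/3) * (s * Im (Ph s w) + 3 * \<omega> * Re (w 2)) / rh s w
     + 4 * s ^ 3 * Im (cnj (uh s w) * gu s w) / rh s w"

text \<open>The self-induced velocity of m is one third of that of v, so m - v / 3 feels the
  background alone.\<close>

definition H4 :: "real \<Rightarrow> (nat \<Rightarrow> complex) \<Rightarrow> complex" where
  "H4 s w = of_real (4 * s ^ 3) * (gm s w - of_real (s\<^sup>2 / 3) * gv s w)"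

definition HY :: "nat \<Rightarrow> real \<Rightarrow> (nat \<Rightarrow> complex) \<Rightarrow> complex" where
  "HY k s w = of_real (4 * s ^ 3) * cnj (c *
     (of_real \<xi> * (1/3 * iz 1 k s w - 2/3 * iz 2 k s w - 2/3 * iz 3 k s w)
      + (\<Sum>h\<in>{1..N} - {k}. of_real (\<zeta> h) / (yy k s w - yy h s w))))"

definition H :: "nat \<Rightarrow> real \<Rightarrow> (nat \<Rightarrow> complex) \<Rightarrow> complex" where
  "H i s w = (if i = 0 then of_real (H0 s w) else if i = 1 then of_real (H1 s w)
     else if i = 2 then of_real (H2 s w) else if i = 3 then of_real (H3 s w)
     else if i = 4 then H4 s w else if i < N + 5 then HY (i - 4) s w else 0)"

text \<open>The weights are the powers of \<open>s\<close> that multiply \<open>Re (w i)\<close> in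
  \<bar>v\<bar>^2 - 3 \<bar>u\<bar>^2, in the deviation of arg (v / u), and in \<bar>u\<bar>^2 -
  \<kappa> s ^ 4.\<close>

definition ord :: "nat \<Rightarrow> nat" where
  "ord i = (if i = 0 then 7 else if i = 1 then 2 else if i = 2 then 5 else 0)"

section \<open>A priori bounds on admissible states\<close>

lemma norm_e: "norm e = 1"
  using p by (metis norm_power one_power2)

lemma rh_bounds:
  assumes "adm S \<mu> s w"
  shows "\<kappa> / 2 \<le> rh s w" "rh s w \<le> 3 * \<kappa> / 2" "\<kappa> / 2 \<le> Rh s w - rh s w" "\<kappa> / 2 \<le> Rh s w" "Rh s w \<le> 5 * \<kappa>"
proof -
  have s: "0 < s" "s \<le> S" "s \<le> 1" and w: "\<bar>Re (w j)\<bar> \<le> \<mu>" for j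
    using assms S(2) abs_Re_le_cmod[of "w j"] by (auto simp: adm_def intro: order_trans)
  \<comment> \<open>Both perturbations stay below \<open>S * \<mu> \<le> \<kappa> / 2\<close>; all
    five bounds are then linear around rh = \<kappa> and Rh = 3 \<kappa>.\<close>
  have "\<bar>s * Re (w 2)\<bar> \<le> S * \<mu>" "\<bar>s ^ 3 * Re (w 0)\<bar> \<le> S * \<mu>"
  proof -
    show "\<bar>s * Re (w 2)\<bar> \<le> S * \<mu>" unfolding abs_mult using s w by (intro mult_mono) auto
    have "s ^ 3 \<le> S" using power_decreasing[of 1 3 s] s by simp
    then show "\<bar>s ^ 3 * Re (w 0)\<bar> \<le> S * \<mu>"
      unfolding abs_mult using s w by (intro mult_mono) auto
  qed
  then obtain a b where ab: "s * Re (w 2) = a" "s ^ 3 * Re (w 0) = b" "\<bar>a\<bar> \<le> \<kappa> / 2" "\<bar>b\<bar> \<le> \<kappa> / 2"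
    using S(3) by force
  have eq: "rh s w = \<kappa> + a" "Rh s w = 3 * \<kappa> + 3 * a + b" by (simp_all add: rh_def Rh_def ab)
  show "\<kappa> / 2 \<le> rh s w" "rh s w \<le> 3 * \<kappa> / 2" "\<kappa> / 2 \<le> Rh s w - rh s w" "\<kappa> / 2 \<le> Rh s w" "Rh s w \<le> 5 * \<kappa>"
    unfolding eq by (insert \<kappa>(1) abs_le_D1[OF ab(3)] abs_le_D2[OF ab(3)] abs_le_D1[OF ab(4)] abs_le_D2[OF ab(4)], linarith+)
qed

lemma rh_pos: "adm S \<mu> s w \<Longrightarrow> 0 < rh s w" and Rh_pos: "adm S \<mu> s w \<Longrightarrow> 0 < Rh s w"
  by (insert rh_bounds[of s w] \<kappa>, linarith+)

lemma norm_uh: "adm S \<mu> s w \<Longrightarrow> norm (uh s w) = sqrt (rh s w)"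
  and norm_vh: "adm S \<mu> s w \<Longrightarrow> norm (vh s w) = sqrt (Rh s w)"
  using rh_pos[of s w] Rh_pos[of s w] p by (auto simp: uh_def vh_def norm_mult)

text \<open>\<open>Xh\<close> has modulus \<open>Rh\<close>, so the gap between \<open>Rh\<close>
  and \<open>rh\<close> keeps the denominator of \<open>P\<close> away from 0 for all
  phases.\<close>

lemma Dh_bound: "adm S \<mu> s w \<Longrightarrow> \<kappa> / 2 \<le> norm (Dh s w)"
  using rh_bounds[of s w] rh_pos[of s w] Rh_pos[of s w] norm_e
    norm_triangle_ineq2[of "Xh s w" "of_real (rh s w)"]
  by (simp add: Dh_def Xh_def norm_mult)

lemma Dh_nz: "adm S \<mu> s w \<Longrightarrow> Dh s w \<noteq> 0"
  using Dh_bound[of s w] \<kappa>(1) by auto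

text \<open>This serves twice: to confine the triple near the origin and to see it collapse there as
  \<open>s\<close> tends to 0. The factor 3 is slack over 1/3 + 1.\<close>

lemma norm_zz_le:
  assumes "adm S \<mu> s w"
  shows "norm (zz j s w) \<le> s\<^sup>2 * (3 * sqrt (5 * \<kappa>)) + norm (w 4)"
proof -
  let ?M = "sqrt (5 * \<kappa>)"
  have u: "norm (uh s w) \<le> ?M" and v: "norm (vh s w) \<le> ?M"
    using rh_bounds[OF assms] \<kappa>(1) by (auto simp: norm_uh norm_vh assms)
  let ?d = "if j = 1 then vh s w else if j = 2 then uh s w else - uh s w"
  have d: "norm ?d \<le> ?M" using u v by simp
  have "norm (zz j s w) \<le> norm (of_real (s\<^sup>2 / 3) * vh s w) + norm (w 4) + norm (of_real (s\<^sup>2) * ?d)"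
    unfolding zz_def mm_def by (intro order_trans[OF norm_triangle_ineq] add_mono) (auto intro: norm_triangle_ineq)
  also have "\<dots> \<le> s\<^sup>2 / 3 * ?M + norm (w 4) + s\<^sup>2 * ?M"
    using v d by (intro add_mono) (auto simp: norm_mult norm_power intro!: mult_left_mono)
  also have "\<dots> \<le> s\<^sup>2 * (3 * ?M) + norm (w 4)" using \<kappa>(1) by (simp add: algebra_simps)
  finally show ?thesis .
qed

lemma norm_zz:
  assumes "adm S \<mu> s w"
  shows "norm (zz j s w) \<le> 2 * \<mu>"
proof -
  have s: "0 < s" "s \<le> S" "s \<le> 1" and w: "norm (w 4) \<le> \<mu>"
    using assms S(2) by (auto simp: adm_def)
  have "s\<^sup>2 * (3 * sqrt (5 * \<kappa>)) \<le> S * (3 * sqrt (5 * \<kappa>))"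
    using s \<kappa>(1) power_decreasing[of 1 2 s] by (intro mult_right_mono) auto
  then show ?thesis using norm_zz_le[OF assms, of j] S(4) w by linarith
qed

text \<open>The distance left is 4 \<mu> - \<mu> - 2 \<mu>: the initial distance of the background
  vortex from 0, less its displacement and the size of the triple.\<close>

lemma zz_yy_bound:
  assumes "adm S \<mu> s w" "h \<in> {1..N}"
  shows "\<mu> \<le> norm (zz j s w - yy h s w)"
proof -
  have "norm (y0 h) - norm (w (h + 4)) \<le> norm (yy h s w)"
    unfolding yy_def by (rule norm_diff_ineq)
  moreover have "norm (w (h + 4)) \<le> \<mu>" using assms by (simp add: adm_def)
  ultimately show ?thesis
    using y0[OF assms(2)] norm_zz[OF assms(1), of j] norm_triangle_ineq3[of "zz j s w" "yy h s w"]
    by linarith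
qed

lemma yy_diff_bound:
  assumes "adm S \<mu> s w" "k \<in> {1..N}" "h \<in> {1..N}" "k \<noteq> h"
  shows "\<mu> \<le> norm (yy k s w - yy h s w)"
proof -
  have "norm (y0 k - y0 h) - norm (w (k + 4) - w (h + 4)) \<le> norm (y0 k - y0 h + (w (k + 4) - w (h + 4)))"
    by (rule norm_diff_ineq)
  moreover have "norm (w (h + 4)) \<le> \<mu>" "norm (w (k + 4)) \<le> \<mu>" using assms by (auto simp: adm_def)
  moreover have "norm (w (k + 4) - w (h + 4)) \<le> norm (w (k + 4)) + norm (w (h + 4))"
    by (rule norm_triangle_ineq4)
  ultimately show ?thesis using y0_diff[OF assms(2-4)] \<mu> by (simp add: yy_def algebra_simps)
qed

section \<open>Tameness of the coefficients\<close>

lemmas tame_basic = tame_const tame_power tame_id tame_proj tame_add tame_diff tame_minus tame_mult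
  tame_Re tame_Im tame_cnj tame_of_real tame_sum tame_cis tame_cis_quotient

lemma tame_rh: "tame S \<mu> rh" and tame_Rh: "tame S \<mu> Rh"
  unfolding rh_def[abs_def] Rh_def[abs_def] by (intro tame_basic)+

lemma tame_div_rh:
  assumes "tame S \<mu> f"
  shows "tame S \<mu> (\<lambda>s w. f s w / rh s w)" "tame S \<mu> (\<lambda>s w. f s w / Rh s w)"
proof -
  show "tame S \<mu> (\<lambda>s w. f s w / rh s w)"
    by (rule tame_divide[OF assms tame_rh, where e = "\<kappa> / 2"]) (use rh_bounds \<kappa>(1) in force)+
  show "tame S \<mu> (\<lambda>s w. f s w / Rh s w)"
    by (rule tame_divide[OF assms tame_Rh, where e = "\<kappa> / 2"]) (use rh_bounds \<kappa>(1) in force)+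
qed

lemma tame_uh: "tame S \<mu> uh" and tame_vh: "tame S \<mu> vh"
proof -
  have l: "continuous_on {0<..S} (\<lambda>s. 4 * \<omega> * ln s)" by (intro continuous_intros) auto
  have "tame S \<mu> (\<lambda>s w. sqrt (rh s w))" "tame S \<mu> (\<lambda>s w. sqrt (Rh s w))"
    using \<kappa>(1) rh_bounds by (auto intro!: tame_sqrt[where e = "\<kappa> / 2"] tame_rh tame_Rh)
  note t = this
  show "tame S \<mu> uh" "tame S \<mu> vh"
    unfolding uh_def[abs_def] vh_def[abs_def] by (intro tame_basic l t)+
qed

lemma tame_Xh: "tame S \<mu> Xh"
  unfolding Xh_def[abs_def] by (intro tame_basic tame_Rh continuous_on_const)

lemma tame_Dh: "tame S \<mu> Dh"
  unfolding Dh_def[abs_def] by (intro tame_basic tame_rh tame_Xh)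

lemma tame_div_Dh:
  assumes "tame S \<mu> f"
  shows "tame S \<mu> (\<lambda>s w. f s w / Dh s w)"
  by (rule tame_divide[OF assms tame_Dh, where e = "\<kappa> / 2"]) (use Dh_bound \<kappa>(1) in auto)

lemma tame_P: "tame S \<mu> P"
  unfolding P_def[abs_def] by (intro tame_div_Dh tame_basic tame_Xh)

lemma tame_Ph: "tame S \<mu> Ph"
  unfolding Ph_def[abs_def] by (intro tame_div_Dh tame_basic tame_rh continuous_on_const)

lemma tame_zz: "tame S \<mu> (zz j)"
proof -
  have t: "tame S \<mu> (\<lambda>s w. complex_of_real (s\<^sup>2 / 3))"
    using tame_mult[OF tame_const[of S \<mu> "1/3"] tame_power[of S \<mu> 2]] tame_of_real by fastforce
  have "tame S \<mu> mm" unfolding mm_def[abs_def] by (intro tame_basic tame_vh t)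
  then show ?thesis
    unfolding zz_def[abs_def] by (intro tame_basic tame_if tame_uh tame_vh)
qed

lemma tame_yy: "tame S \<mu> (yy k)"
  unfolding yy_def[abs_def] by (intro tame_basic)

lemma tame_iz: "h \<in> {1..N} \<Longrightarrow> tame S \<mu> (iz j h)"
  unfolding iz_def[abs_def]
  by (rule tame_divide[where e = \<mu>]) (use zz_yy_bound \<mu> in \<open>auto intro!: tame_basic tame_zz tame_yy\<close>)

lemma tame_gu: "tame S \<mu> gu" and tame_gv: "tame S \<mu> gv" and tame_gm: "tame S \<mu> gm"
  unfolding gu_def[abs_def] gv_def[abs_def] gm_def[abs_def]
  by (intro tame_basic tame_uh tame_vh tame_iz; assumption)+

lemma tame_HY: 
  assumes k: "k \<in> {1..N}"
  shows "tame S \<mu> (HY k)"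
proof -
  have "tame S \<mu> (\<lambda>s w. of_real (\<zeta> h) / (yy k s w - yy h s w))" if "h \<in> {1..N} - {k}" for h
    by (rule tame_divide[where e = \<mu>]) (use that k \<mu> yy_diff_bound in \<open>auto intro!: tame_basic tame_yy\<close>)
  then show ?thesis
    unfolding HY_def[abs_def] using k by (intro tame_basic tame_iz)
qed

lemma tame_H: "tame S \<mu> (H i)"
proof -
  have t: "tame S \<mu> (\<lambda>s w. complex_of_real (s\<^sup>2 / 3))"
    using tame_mult[OF tame_const[of S \<mu> "1/3"] tame_power[of S \<mu> 2]] tame_of_real by fastforce
  have "tame S \<mu> (\<lambda>s w. complex_of_real (H0 s w))"
    unfolding H0_def by (intro tame_basic tame_uh tame_vh tame_gu tame_gv)
  moreover have "tame S \<mu> (\<lambda>s w. complex_of_real (H1 s w))"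
    unfolding H1_def by (intro tame_of_real tame_div_rh tame_basic tame_P tame_uh tame_vh tame_gu tame_gv)
  moreover have "tame S \<mu> (\<lambda>s w. complex_of_real (H2 s w))"
    unfolding H2_def by (intro tame_basic tame_Ph tame_uh tame_gu)
  moreover have "tame S \<mu> (\<lambda>s w. complex_of_real (H3 s w))"
    unfolding H3_def by (intro tame_of_real tame_div_rh tame_basic tame_Ph tame_uh tame_gu)
  moreover have "tame S \<mu> H4"
    unfolding H4_def[abs_def] by (intro tame_basic t tame_gm tame_gv)
  moreover have "tame S \<mu> (HY (i - 4))" if "i \<noteq> 0" "i \<noteq> 1" "i \<noteq> 2" "i \<noteq> 3" "i \<noteq> 4" "i < N + 5"
    using that by (intro tame_HY) auto
  ultimately show ?thesis
    unfolding H_def[abs_def] by (intro tame_if tame_const)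
qed

section \<open>Identities for the self-interaction and the background\<close>

lemma P_eq:
  assumes "adm S \<mu> s w"
  shows "P s w = P0 + of_real (s\<^sup>2) * Ph s w"
proof -
  have s: "s > 0" using assms by (simp add: adm_def)
  define C where "C = cis (s\<^sup>2 * (2 * Re (w 1)))"
  define D where "D = Dh s w"
  define a where "a = complex_of_real (rh s w)"
  define b where "b = complex_of_real (s * Re (w 0))"
  define q where "q = complex_of_real (s\<^sup>2)"
  have D: "D = e * (3 * a + q * b) * C - a" "D \<noteq> 0"
    using Dh_nz[OF assms] by (simp_all add: D_def Dh_def Xh_def Rh_def C_def a_def b_def q_def power3_eq_cube power2_eq_square)
  have X: "Xh s w = D + a" by (simp add: D_def Dh_def a_def)
  have q: "q \<noteq> 0" using s by (simp add: q_def)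
  have e': "3 * e - 1 \<noteq> 0" using e by simp
  \<comment> \<open>The squared ratio leaves \<open>3 * e\<close> in two ways, by its angle through
    \<open>1 - C\<close> and by its modulus through \<open>b\<close>; both deviations carry the
    factor \<open>q\<close>, and \<open>T\<close> is what remains.\<close>
  define T where "T = 3 * a * ((1 - C) / q) - b * C"
  have qT: "q * T = 3 * a * (1 - C) - q * b * C"
    using q by (simp add: T_def field_simps)
  have Ph: "Ph s w = of_real \<xi> * c * e / (3 * e - 1) * T / D"
    by (simp add: Ph_def T_def C_def D_def a_def b_def q_def)
  have "P0 + q * Ph s w = of_real \<xi> * c * (3 * e / (3 * e - 1) + e / (3 * e - 1) * (q * T) / D)"
    by (simp add: P0 Ph distrib_left mult_ac)
  also have "3 * e / (3 * e - 1) + e / (3 * e - 1) * (q * T) / D = (D + a) / D"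
  proof -
    \<comment> \<open>\<open>D + a\<close> equals \<open>e * (3 * a + q * b) * C\<close>, so the
      left side collapses to a multiple of \<open>D + a\<close>.\<close>
    have "3 * e * D + e * (3 * a * (1 - C) - q * b * C) = (3 * e - 1) * (D + a)"
      unfolding D(1) by (simp add: algebra_simps)
    then have "(3 * e * D + e * (q * T)) / ((3 * e - 1) * D) = (D + a) / D"
      using e' by (simp add: qT)
    then show ?thesis using D(2) by (simp add: add_divide_distrib)
  qed
  finally show ?thesis by (simp add: P_def X D_def q_def)
qed

lemma Re_P: "adm S \<mu> s w \<Longrightarrow> Re (P s w) = 3 * \<kappa> / 2 + s\<^sup>2 * Re (Ph s w)"
  and Im_P: "adm S \<mu> s w \<Longrightarrow> Im (P s w) = - 3 * \<kappa> * \<omega> + s\<^sup>2 * Im (Ph s w)"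
  by (simp_all add: P_eq \<kappa> \<omega> del: of_real_power)

text \<open>The squares of \<open>vh\<close> and \<open>uh\<close> share a phase factor, which drops
  out of the quotient; \<open>P\<close> is thus the scale-invariant self-interaction at the
  perturbed state.\<close>

lemma P_over_vh:
  assumes "adm S \<mu> s w"
  shows "vh s w ^ 2 - uh s w ^ 2 \<noteq> 0"
    "P s w = of_real \<xi> * c * (vh s w)\<^sup>2 / ((vh s w)\<^sup>2 - (uh s w)\<^sup>2)"
proof -
  define C where "C = cis (4 * \<omega> * ln s + Re (w 3)) ^ 2"
  have C: "C \<noteq> 0" by (simp add: C_def)
  have sq: "complex_of_real (sqrt x) ^ 2 = of_real x" if "x > 0" for x
    using that by (simp flip: of_real_power)
  have "cis (4 * \<omega> * ln s + (Re (w 3) + s\<^sup>2 * Re (w 1))) ^ 2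
      = C * cis (s\<^sup>2 * (2 * Re (w 1)))"
    unfolding C_def power2_eq_square by (simp add: cis_mult algebra_simps)
  then have v: "(vh s w)\<^sup>2 = C * Xh s w"
    using Rh_pos[OF assms] by (simp add: vh_def Xh_def power_mult_distrib p sq)
  have u: "(uh s w)\<^sup>2 = C * of_real (rh s w)"
    using rh_pos[OF assms] by (simp add: uh_def power_mult_distrib sq C_def)
  have d: "(vh s w)\<^sup>2 - (uh s w)\<^sup>2 = C * Dh s w"
    unfolding v u Dh_def by (simp add: algebra_simps)
  show "(vh s w)\<^sup>2 - (uh s w)\<^sup>2 \<noteq> 0" using C Dh_nz[OF assms] by (simp add: d)
  show "P s w = of_real \<xi> * c * (vh s w)\<^sup>2 / ((vh s w)\<^sup>2 - (uh s w)\<^sup>2)"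
    unfolding d unfolding v P_def using C by simp
qed

text \<open>The resolvent identity 1/x - 1/y = (y - x) / (x y) turns differences of the background
  velocity within the triple into multiples of differences of positions, which are
  \<open>s\<^sup>2\<close> times bounded quantities.\<close>

lemma background:
  assumes "adm S \<mu> s w"
  shows "gm s w + of_real (s\<^sup>2) * gv s w = cnj (c * (\<Sum>h\<in>{1..N}. of_real (\<zeta> h) * iz 1 h s w))"
    and "gm s w + of_real (s\<^sup>2) * gu s w = cnj (c * (\<Sum>h\<in>{1..N}. of_real (\<zeta> h) * iz 2 h s w))"
    and "gm s w - of_real (s\<^sup>2) * gu s w = cnj (c * (\<Sum>h\<in>{1..N}. of_real (\<zeta> h) * iz 3 h s w))"
proof -
  let ?q = "complex_of_real (s\<^sup>2)"
  have d: "iz i h s w - iz j h s w = (zz j s w - zz i s w) * iz i h s w * iz j h s w"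
    if "h \<in> {1..N}" for i j h
  proof -
    have "zz i s w - yy h s w \<noteq> 0" "zz j s w - yy h s w \<noteq> 0"
      using zz_yy_bound[OF assms that, of i] zz_yy_bound[OF assms that, of j] \<mu> by auto
    then show ?thesis unfolding iz_def by (simp add: divide_simps) 
  qed
  have z: "zz 3 s w - zz 2 s w = - 2 * ?q * uh s w" "zz 2 s w - zz 1 s w = ?q * (uh s w - vh s w)"
    "zz 3 s w - zz 1 s w = - ?q * (uh s w + vh s w)"
    by (simp_all add: zz_def algebra_simps)
  have h1: "1/2 * (iz 2 h s w + iz 3 h s w) + ?q * (1/2 * ((uh s w - vh s w) * iz 1 h s w * iz 2 h s w - (uh s w + vh s w) * iz 1 h s w * iz 3 h s w))
      = iz 1 h s w" (is "?l = _") if "h \<in> {1..N}" for h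
  proof -
    \<comment> \<open>The first vortex is compared with the second and with the third, and the two
      results are averaged.\<close>
    have "?l = 1/2 * ((iz 2 h s w + ?q * (uh s w - vh s w) * iz 1 h s w * iz 2 h s w)
        + (iz 3 h s w + - ?q * (uh s w + vh s w) * iz 1 h s w * iz 3 h s w))"
      by (simp add: field_simps)
    also have "iz 2 h s w + ?q * (uh s w - vh s w) * iz 1 h s w * iz 2 h s w = iz 1 h s w"
      using d[OF that, of 1 2] unfolding z by (simp add: diff_eq_eq add.commute)
    also have "iz 3 h s w + - ?q * (uh s w + vh s w) * iz 1 h s w * iz 3 h s w = iz 1 h s w"
      using d[OF that, of 1 3] unfolding z by (simp add: diff_eq_eq add.commute)
    finally show ?thesis by simp
  qed
  have h2: "1/2 * (iz 2 h s w + iz 3 h s w) + ?q * (- uh s w * iz 2 h s w * iz 3 h s w) = iz 2 h s w"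
    and h3: "1/2 * (iz 2 h s w + iz 3 h s w) - ?q * (- uh s w * iz 2 h s w * iz 3 h s w) = iz 3 h s w"
    if "h \<in> {1..N}" for h
  proof -
    have "?q * (- uh s w * iz 2 h s w * iz 3 h s w) = (iz 2 h s w - iz 3 h s w) / 2"
      unfolding d[OF that, of 2 3] z by simp
    then show "1/2 * (iz 2 h s w + iz 3 h s w) + ?q * (- uh s w * iz 2 h s w * iz 3 h s w) = iz 2 h s w"
      "1/2 * (iz 2 h s w + iz 3 h s w) - ?q * (- uh s w * iz 2 h s w * iz 3 h s w) = iz 3 h s w"
      by (simp_all only:) (simp_all add: field_simps)
  qed
  have comb: "cnj (c * (\<Sum>h\<in>{1..N}. of_real (\<zeta> h) * f h)) + ?q * cnj (c * (\<Sum>h\<in>{1..N}. of_real (\<zeta> h) * g h))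
      = cnj (c * (\<Sum>h\<in>{1..N}. of_real (\<zeta> h) * k h))" if "\<And>h. h \<in> {1..N} \<Longrightarrow> f h + ?q * g h = k h" for f g k
  proof -
    have "(\<Sum>h\<in>{1..N}. of_real (\<zeta> h) * k h) = (\<Sum>h\<in>{1..N}. of_real (\<zeta> h) * f h) + ?q * (\<Sum>h\<in>{1..N}. of_real (\<zeta> h) * g h)"
      unfolding sum_distrib_left sum.distrib[symmetric]
      by (rule sum.cong) (auto simp flip: that simp: algebra_simps)
    then show ?thesis by (simp add: algebra_simps)
  qed
  show "gm s w + ?q * gv s w = cnj (c * (\<Sum>h\<in>{1..N}. of_real (\<zeta> h) * iz 1 h s w))"
    unfolding gm_def gv_def by (rule comb) (rule h1)
  show "gm s w + ?q * gu s w = cnj (c * (\<Sum>h\<in>{1..N}. of_real (\<zeta> h) * iz 2 h s w))"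
    unfolding gm_def gu_def by (rule comb) (rule h2)
  have "gm s w + ?q * (- gu s w) = cnj (c * (\<Sum>h\<in>{1..N}. of_real (\<zeta> h) * iz 3 h s w))"
  proof -
    have "- gu s w = cnj (c * (\<Sum>h\<in>{1..N}. of_real (\<zeta> h) * (uh s w * iz 2 h s w * iz 3 h s w)))"
      by (simp add: gu_def sum_negf)
    then show ?thesis unfolding gm_def by (simp only:, intro comb) (use h3 in simp)
  qed
  then show "gm s w - ?q * gu s w = cnj (c * (\<Sum>h\<in>{1..N}. of_real (\<zeta> h) * iz 3 h s w))" by simp
qed

section \<open>From the scaled solution to the vortex velocities\<close>

context
  fixes w :: "nat \<Rightarrow> real \<Rightarrow> complex" and S1 :: real
  assumes S1: "S1 \<le> S"
    and w_bound: "\<And>i s. norm (w i s) \<le> \<mu>"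
    and w_deriv: "\<And>i s. 0 < s \<Longrightarrow> s < S1 \<Longrightarrow>
      ((\<lambda>s. of_real (s ^ ord i) * w i s) has_vector_derivative
         of_real (s ^ ord i) * H i s (\<lambda>j. w j s)) (at s)"
begin

abbreviation (input) W :: "real \<Rightarrow> nat \<Rightarrow> complex" where
  "W s \<equiv> \<lambda>j. w j s"

lemma adm_W: "0 < s \<Longrightarrow> s < S1 \<Longrightarrow> adm S \<mu> s (W s)"
  using S1 w_bound by (auto simp: adm_def)

lemma Re_w_deriv:
  assumes "0 < s" "s < S1"
  shows "((\<lambda>s. s ^ ord i * Re (w i s)) has_real_derivative s ^ ord i * Re (H i s (W s))) (at s)"
  using has_field_derivative_Re[OF w_deriv[OF assms, of i]] by simp

text \<open>\<open>Bu\<close> and \<open>Bv\<close> are the intended values of cnj u * du/ds and cnj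
  v * dv/ds. Here \<open>4 * s ^ 3\<close> is dt/ds, and \<open>s ^ 4\<close> joins the
  \<open>s\<^sup>2\<close> of cnj u or cnj v with the \<open>s\<^sup>2\<close> that scales
  \<open>gu\<close> or \<open>gv\<close>.\<close>

definition Bu :: "real \<Rightarrow> complex" where
  "Bu s = of_real (4 * s ^ 3) * (cnj (P s (W s)) / 3 + of_real (s ^ 4) * (cnj (uh s (W s)) * gu s (W s)))"

definition Bv :: "real \<Rightarrow> complex" where
  "Bv s = of_real (4 * s ^ 3) * (cnj (P s (W s)) + of_real (s ^ 4) * (cnj (vh s (W s)) * gv s (W s)))"

lemma Bu_parts:
  "Re (Bu s) = 4 * s ^ 3 * (Re (P s (W s)) / 3 + s ^ 4 * Re (cnj (uh s (W s)) * gu s (W s)))"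
  "Im (Bu s) = 4 * s ^ 3 * (- Im (P s (W s)) / 3 + s ^ 4 * Im (cnj (uh s (W s)) * gu s (W s)))"
  and Bv_parts:
  "Re (Bv s) = 4 * s ^ 3 * (Re (P s (W s)) + s ^ 4 * Re (cnj (vh s (W s)) * gv s (W s)))"
  "Im (Bv s) = 4 * s ^ 3 * (- Im (P s (W s)) + s ^ 4 * Im (cnj (vh s (W s)) * gv s (W s)))"
proof -
  have *: "Re (of_real a * (cnj z / 3 + of_real b * y)) = a * (Re z / 3 + b * Re y)"
    "Im (of_real a * (cnj z / 3 + of_real b * y)) = a * (- Im z / 3 + b * Im y)"
    "Re (of_real a * (cnj z + of_real b * y)) = a * (Re z + b * Re y)"
    "Im (of_real a * (cnj z + of_real b * y)) = a * (- Im z + b * Im y)" for a b y z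
    by simp_all
  show "Re (Bu s) = 4 * s ^ 3 * (Re (P s (W s)) / 3 + s ^ 4 * Re (cnj (uh s (W s)) * gu s (W s)))"
    "Im (Bu s) = 4 * s ^ 3 * (- Im (P s (W s)) / 3 + s ^ 4 * Im (cnj (uh s (W s)) * gu s (W s)))"
    "Re (Bv s) = 4 * s ^ 3 * (Re (P s (W s)) + s ^ 4 * Re (cnj (vh s (W s)) * gv s (W s)))"
    "Im (Bv s) = 4 * s ^ 3 * (- Im (P s (W s)) + s ^ 4 * Im (cnj (vh s (W s)) * gv s (W s)))"
    unfolding Bu_def Bv_def by (rule *)+
qed

lemma r_deriv:
  assumes s: "0 < s" "s < S1"
  shows "((\<lambda>s. s ^ 4 * rh s (W s)) has_real_derivative 2 * Re (Bu s)) (at s)"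
proof -
  have "((\<lambda>s. \<kappa> * s ^ 4 + s ^ 5 * Re (w 2 s)) has_real_derivative \<kappa> * (4 * s ^ 3) + s ^ 5 * H2 s (W s)) (at s)"
    using Re_w_deriv[OF s, of 2] by (intro DERIV_add) (auto simp: ord_def H_def intro!: derivative_eq_intros)
  moreover have "\<kappa> * (4 * s ^ 3) + s ^ 5 * H2 s (W s) = 2 * Re (Bu s)"
    unfolding H2_def Bu_parts Re_P[OF adm_W[OF s]] by (simp add: algebra_simps flip: power_add)
  moreover have "(\<lambda>s. s ^ 4 * rh s (W s)) = (\<lambda>s. \<kappa> * s ^ 4 + s ^ 5 * Re (w 2 s))"
    by (auto simp: rh_def algebra_simps eval_nat_numeral)
  ultimately show ?thesis by simp
qed

text \<open>\<open>P\<close> enters \<open>Bv\<close> with three times its coefficient in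
  \<open>Bu\<close>, so it cancels from \<bar>v\<bar>^2 - 3 \<bar>u\<bar>^2, which changes through
  the background alone.\<close>

lemma R_deriv:
  assumes s: "0 < s" "s < S1"
  shows "((\<lambda>s. s ^ 4 * Rh s (W s)) has_real_derivative 2 * Re (Bv s)) (at s)"
proof -
  have "((\<lambda>s. 3 * (s ^ 4 * rh s (W s)) + s ^ 7 * Re (w 0 s)) has_real_derivative 3 * (2 * Re (Bu s)) + s ^ 7 * H0 s (W s)) (at s)"
    using Re_w_deriv[OF s, of 0] by (intro DERIV_add DERIV_cmult r_deriv s) (simp add: ord_def H_def)
  moreover have "3 * (2 * Re (Bu s)) + s ^ 7 * H0 s (W s) = 2 * Re (Bv s)"
    unfolding H0_def Bu_parts Bv_parts by (simp add: algebra_simps flip: power_add)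
  moreover have "(\<lambda>s. s ^ 4 * Rh s (W s)) = (\<lambda>s. 3 * (s ^ 4 * rh s (W s)) + s ^ 7 * Re (w 0 s))"
    by (auto simp: Rh_def algebra_simps simp flip: power_add)
  ultimately show ?thesis by simp
qed

lemma theta_u_deriv:
  assumes s: "0 < s" "s < S1"
  shows "((\<lambda>s. 4 * \<omega> * ln s + Re (w 3 s)) has_real_derivative Im (Bu s) / (s ^ 4 * rh s (W s))) (at s)"
proof -
  have "((\<lambda>s. 4 * \<omega> * ln s + Re (w 3 s)) has_real_derivative 4 * \<omega> * (1 / s) + H3 s (W s)) (at s)"
    using Re_w_deriv[OF s, of 3] s by (intro DERIV_add DERIV_cmult DERIV_ln_divide) (simp_all add: ord_def H_def)
  moreover have "4 * \<omega> * (1 / s) + H3 s (W s) = Im (Bu s) / (s ^ 4 * rh s (W s))"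
  proof -
    define g where "g = Im (cnj (uh s (W s)) * gu s (W s))"
    define h where "h = Im (Ph s (W s))"
    define x where "x = Re (w 2 s)"
    define r where "r = rh s (W s)"
    have r: "r = \<kappa> + s * x" "r \<noteq> 0" using rh_pos[OF adm_W[OF s]] by (auto simp: r_def rh_def x_def)
    have "(4 * \<omega> * (1 / s) + (- (4/3) * (s * h + 3 * \<omega> * x) / r + 4 * s ^ 3 * g / r)) * (s ^ 4 * r)
        = 4 * s ^ 3 * (- (- 3 * \<kappa> * \<omega> + s\<^sup>2 * h) / 3 + s ^ 4 * g)"
    proof -
      have "(4 * \<omega> * (1 / s) + (- (4/3) * (s * h + 3 * \<omega> * x) / r + 4 * s ^ 3 * g / r)) * (s ^ 4 * r)
        = 4 * \<omega> * s ^ 3 * r - (4/3) * (s * h + 3 * \<omega> * x) * s ^ 4 + 4 * s ^ 7 * g"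
        using s r(2) by (simp add: field_simps eval_nat_numeral)
      also have "\<dots> = 4 * s ^ 3 * (- (- 3 * \<kappa> * \<omega> + s\<^sup>2 * h) / 3 + s ^ 4 * g)"
        unfolding r(1) by (simp add: field_simps eval_nat_numeral)
      finally show ?thesis .
    qed
    then show ?thesis
      unfolding Bu_parts Im_P[OF adm_W[OF s]] H3_def g_def[symmetric] h_def[symmetric] x_def[symmetric] r_def[symmetric]
      using s r(2) by (simp add: eq_divide_eq)
  qed
  ultimately show ?thesis by simp
qed

lemma theta_v_deriv:
  assumes s: "0 < s" "s < S1"
  shows "((\<lambda>s. 4 * \<omega> * ln s + (Re (w 3 s) + s\<^sup>2 * Re (w 1 s))) has_real_derivative Im (Bv s) / (s ^ 4 * Rh s (W s))) (at s)"
proof -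
  have "((\<lambda>s. (4 * \<omega> * ln s + Re (w 3 s)) + s\<^sup>2 * Re (w 1 s)) has_real_derivative Im (Bu s) / (s ^ 4 * rh s (W s)) + s\<^sup>2 * H1 s (W s)) (at s)"
    using Re_w_deriv[OF s, of 1] by (intro DERIV_add theta_u_deriv s) (simp add: ord_def H_def)
  moreover have "Im (Bu s) / (s ^ 4 * rh s (W s)) + s\<^sup>2 * H1 s (W s) = Im (Bv s) / (s ^ 4 * Rh s (W s))"
  proof -
    define g where "g = Im (cnj (uh s (W s)) * gu s (W s))"
    define h where "h = Im (cnj (vh s (W s)) * gv s (W s))"
    define q where "q = Im (P s (W s))"
    define x where "x = Re (w 0 s)"
    define r where "r = rh s (W s)"
    define R where "R = Rh s (W s)"
    have r: "R = 3 * r + s ^ 3 * x" "r \<noteq> 0" "R \<noteq> 0"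
      using rh_pos[OF adm_W[OF s]] Rh_pos[OF adm_W[OF s]] by (auto simp: r_def R_def Rh_def x_def)
    have "(4 * s ^ 3 * (- q / 3 + s ^ 4 * g) / (s ^ 4 * r) + s\<^sup>2 * (4/3 * q * x / r / R + 4 * s * (h / R - g / r))) * (s * r * R)
        = - (4/3) * q * R + 4 * s ^ 4 * g * R + (4/3) * s ^ 3 * q * x + 4 * s ^ 4 * (h * r - g * R)"
      using s r(2,3) by (simp add: field_simps eval_nat_numeral)
    also have "\<dots> = - (4/3) * q * (R - s ^ 3 * x) + 4 * s ^ 4 * h * r"
      by (simp add: field_simps)
    \<comment> \<open>The meaning of \<open>w 0\<close> enters here: it converts the
      self-interaction rate of arg u, with its correction, into that of arg v.\<close>
    also have "R - s ^ 3 * x = 3 * r" using r(1) by simp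
    also have "- (4/3) * q * (3 * r) + 4 * s ^ 4 * h * r = 4 * s ^ 3 * (- q + s ^ 4 * h) / (s ^ 4 * R) * (s * r * R)"
      using s r(2,3) by (simp add: field_simps eval_nat_numeral)
    finally have eq: "(4 * s ^ 3 * (- q / 3 + s ^ 4 * g) / (s ^ 4 * r) + s\<^sup>2 * (4/3 * q * x / r / R + 4 * s * (h / R - g / r))) * (s * r * R)
        = 4 * s ^ 3 * (- q + s ^ 4 * h) / (s ^ 4 * R) * (s * r * R)" .
    have "s * r * R \<noteq> 0" using s r(2,3) by simp
    from mult_right_cancel[OF this, THEN iffD1, OF eq] show ?thesis
      unfolding Bu_parts Bv_parts H1_def g_def h_def x_def r_def R_def q_def .
  qed
  ultimately show ?thesis by (simp add: add.assoc)
qed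

lemma U_deriv:
  assumes s: "0 < s" "s < S1"
  shows "((\<lambda>s. of_real (s\<^sup>2) * uh s (W s)) has_vector_derivative Bu s / cnj (of_real (s\<^sup>2) * uh s (W s))) (at s)"
proof -
  have "of_real (s\<^sup>2) * uh s (W s) = 1 * of_real (sqrt (s ^ 4 * rh s (W s))) * cis (4 * \<omega> * ln s + Re (w 3 s))" for s
    using real_sqrt_abs[of "s\<^sup>2"] by (simp add: uh_def real_sqrt_mult flip: power_mult)
  then show ?thesis
    using polar_has_vector_derivative[OF r_deriv[OF s] theta_u_deriv[OF s], of 1] s rh_pos[OF adm_W[OF s]] by simp
qed

lemma V_deriv:
  assumes s: "0 < s" "s < S1"
  shows "((\<lambda>s. of_real (s\<^sup>2) * vh s (W s)) has_vector_derivative Bv s / cnj (of_real (s\<^sup>2) * vh s (W s))) (at s)"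
proof -
  have "of_real (s\<^sup>2) * vh s (W s) = p * of_real (sqrt (s ^ 4 * Rh s (W s))) * cis (4 * \<omega> * ln s + (Re (w 3 s) + s\<^sup>2 * Re (w 1 s)))" for s
    using real_sqrt_abs[of "s\<^sup>2"] by (simp add: vh_def real_sqrt_mult flip: power_mult)
  then show ?thesis
    using polar_has_vector_derivative[OF R_deriv[OF s] theta_v_deriv[OF s], of p] s p Rh_pos[OF adm_W[OF s]] by simp
qed

lemma uh_nz: "0 < s \<Longrightarrow> s < S1 \<Longrightarrow> uh s (W s) \<noteq> 0"
  and vh_nz: "0 < s \<Longrightarrow> s < S1 \<Longrightarrow> vh s (W s) \<noteq> 0"
  using norm_uh[OF adm_W] norm_vh[OF adm_W] rh_pos[OF adm_W] Rh_pos[OF adm_W]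
  by (metis less_irrefl norm_zero real_sqrt_eq_zero_cancel_iff)+

lemma zz_has_vector_derivative:
  assumes s: "0 < s" "s < S1" and j: "j \<in> {1..3}"
    and \<xi>s: "\<xi>s 1 = - (1/3) * \<xi>" "\<xi>s 2 = 2/3 * \<xi>" "\<xi>s 3 = 2/3 * \<xi>"
  shows "((\<lambda>s. zz j s (W s)) has_vector_derivative of_real (4 * s ^ 3) * cnj
     (c * (\<Sum>l\<in>{1..3} - {j}. of_real (\<xi>s l) / (zz j s (W s) - zz l s (W s)))
      + c * (\<Sum>h\<in>{1..N}. of_real (\<zeta> h) / (zz j s (W s) - yy h s (W s))))) (at s)"
proof -
  note a = adm_W[OF s]
  define q where "q = complex_of_real (s\<^sup>2)"
  define k where "k = complex_of_real (4 * s ^ 3)"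
  define U where "U = q * uh s (W s)"
  define V where "V = q * vh s (W s)"
  define K where "K = of_real \<xi> * c"
  \<comment> \<open>The self-induced velocities of v and u will be \<open>cnj A\<close> and
    \<open>cnj B\<close>, in the notation of \<open>pair_interaction\<close>.\<close>
  define A where "A = K * V / (V\<^sup>2 - U\<^sup>2)"
  define B where "B = K * V\<^sup>2 / (V\<^sup>2 - U\<^sup>2) / (3 * U)"
  have q: "q \<noteq> 0" using s by (simp add: q_def)
  have cq: "cnj q = q" by (simp add: q_def)
  have q4: "complex_of_real (s ^ 4) = q * q" by (simp add: q_def flip: of_real_mult power_add)
  have nz: "U \<noteq> 0" "V \<noteq> 0" using q uh_nz[OF s] vh_nz[OF s] by (auto simp: U_def V_def)
  have VU: "V\<^sup>2 - U\<^sup>2 = q\<^sup>2 * ((vh s (W s))\<^sup>2 - (uh s (W s))\<^sup>2)"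
    by (simp add: U_def V_def power_mult_distrib right_diff_distrib)
  have VU0: "V\<^sup>2 - U\<^sup>2 \<noteq> 0" unfolding VU using q P_over_vh(1)[OF a] by simp
  have PK: "P s (W s) = K * V\<^sup>2 / (V\<^sup>2 - U\<^sup>2)"
    unfolding VU P_over_vh(2)[OF a] using q by (simp add: K_def V_def power_mult_distrib)
  have PV: "P s (W s) / V = A" unfolding PK A_def using nz by (simp add: power2_eq_square)
  have PU: "P s (W s) / (3 * U) = B" unfolding PK B_def ..
  have dU: "((\<lambda>s. of_real (s\<^sup>2) * uh s (W s)) has_vector_derivative k * (cnj B + q * gu s (W s))) (at s)"
  proof -
    have "Bu s / cnj U = k * (cnj (P s (W s) / (3 * U)) + q * gu s (W s))"
      using nz q uh_nz[OF s] unfolding Bu_def k_def[symmetric] q4 U_def by (simp add: cq field_simps)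
    then show ?thesis using U_deriv[OF s, folded q_def, folded U_def] by (simp only: PU)
  qed
  have dV: "((\<lambda>s. of_real (s\<^sup>2) * vh s (W s)) has_vector_derivative k * (cnj A + q * gv s (W s))) (at s)"
  proof -
    have "Bv s / cnj V = k * (cnj (P s (W s) / V) + q * gv s (W s))"
      using nz q vh_nz[OF s] unfolding Bv_def k_def[symmetric] q4 V_def by (simp add: cq field_simps)
    then show ?thesis using V_deriv[OF s, folded q_def, folded V_def] by (simp only: PV)
  qed
  have dw: "(w 4 has_vector_derivative k * (gm s (W s) - q / 3 * gv s (W s))) (at s)"
    using w_deriv[OF s, of 4] by (simp add: ord_def H_def H4_def k_def q_def)
  have dm: "((\<lambda>s. mm s (W s)) has_vector_derivative k * (cnj A / 3 + gm s (W s))) (at s)"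
  proof -
    have "((\<lambda>s. 1/3 * (of_real (s\<^sup>2) * vh s (W s)) + w 4 s) has_vector_derivative
        1/3 * (k * (cnj A + q * gv s (W s))) + k * (gm s (W s) - q / 3 * gv s (W s))) (at s)"
      by (intro has_vector_derivative_add has_vector_derivative_mult_right dV dw)
    moreover have "1/3 * (k * (cnj A + q * gv s (W s))) + k * (gm s (W s) - q / 3 * gv s (W s)) = k * (cnj A / 3 + gm s (W s))"
      by (simp add: algebra_simps)
    ultimately show ?thesis by (simp add: mm_def)
  qed
  have z: "zz 1 s (W s) - zz 2 s (W s) = V - U" "zz 1 s (W s) - zz 3 s (W s) = V + U"
    "zz 2 s (W s) - zz 1 s (W s) = U - V" "zz 2 s (W s) - zz 3 s (W s) = 2 * U"
    "zz 3 s (W s) - zz 1 s (W s) = - U - V" "zz 3 s (W s) - zz 2 s (W s) = - 2 * U"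
    by (simp_all add: zz_def U_def V_def q_def algebra_simps)
  have bg: "(\<Sum>h\<in>{1..N}. of_real (\<zeta> h) / (zz i s (W s) - yy h s (W s))) = (\<Sum>h\<in>{1..N}. of_real (\<zeta> h) * iz i h s (W s))" for i
    by (simp add: iz_def)
  note bgs = background[OF a, folded q_def]
  note pi = pair_interaction[OF VU0 nz(1), of K, folded A_def B_def]
  have \<xi>c: "complex_of_real (\<xi>s 1) = - (of_real \<xi> * (1/3))" "complex_of_real (\<xi>s 2) = of_real \<xi> * (2/3)" "complex_of_real (\<xi>s 3) = of_real \<xi> * (2/3)"
    unfolding \<xi>s by simp_all
  consider "j = 1" | "j = 2" | "j = 3" using j by force
  then show ?thesis
  proof cases
    case 1
    have "((\<lambda>s. mm s (W s) + of_real (s\<^sup>2) * vh s (W s)) has_vector_derivative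
        k * (cnj A / 3 + gm s (W s)) + k * (cnj A + q * gv s (W s))) (at s)"
      by (intro has_vector_derivative_add dm dV)
    moreover have "k * (cnj A / 3 + gm s (W s)) + k * (cnj A + q * gv s (W s)) = k * (cnj (4/3 * A) + (gm s (W s) + q * gv s (W s)))"
      by (simp add: algebra_simps)
    moreover have "c * (\<Sum>l\<in>{1..3} - {j}. of_real (\<xi>s l) / (zz j s (W s) - zz l s (W s))) = 4/3 * A"
    proof -
      have "{1..3} - {1} = {2, 3::nat}" by auto
      then show ?thesis unfolding pi(1)[symmetric] using z z[unfolded One_nat_def] by (simp add: 1 \<xi>c \<xi>c(1)[unfolded One_nat_def] K_def algebra_simps)
    qed
    moreover have "(\<lambda>s. zz 1 s (W s)) = (\<lambda>s. mm s (W s) + of_real (s\<^sup>2) * vh s (W s))"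
      by (simp add: zz_def)
    ultimately show ?thesis by (simp only: 1 bg bgs k_def complex_cnj_add)
  next
    case 2
    have "((\<lambda>s. mm s (W s) + of_real (s\<^sup>2) * uh s (W s)) has_vector_derivative
        k * (cnj A / 3 + gm s (W s)) + k * (cnj B + q * gu s (W s))) (at s)"
      by (intro has_vector_derivative_add dm dU)
    moreover have "k * (cnj A / 3 + gm s (W s)) + k * (cnj B + q * gu s (W s)) = k * (cnj (A / 3 + B) + (gm s (W s) + q * gu s (W s)))"
      by (simp add: algebra_simps)
    moreover have "c * (\<Sum>l\<in>{1..3} - {j}. of_real (\<xi>s l) / (zz j s (W s) - zz l s (W s))) = A / 3 + B"
    proof -
      have "{1..3} - {2} = {1, 3::nat}" by auto
      then show ?thesis unfolding pi(2)[symmetric] using z z[unfolded One_nat_def] by (simp add: 2 \<xi>c \<xi>c(1)[unfolded One_nat_def] K_def algebra_simps)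
    qed
    moreover have "(\<lambda>s. zz 2 s (W s)) = (\<lambda>s. mm s (W s) + of_real (s\<^sup>2) * uh s (W s))"
      by (simp add: zz_def)
    ultimately show ?thesis by (simp only: 2 bg bgs k_def complex_cnj_add)
  next
    case 3
    have "((\<lambda>s. mm s (W s) - of_real (s\<^sup>2) * uh s (W s)) has_vector_derivative
        k * (cnj A / 3 + gm s (W s)) - k * (cnj B + q * gu s (W s))) (at s)"
      by (intro has_vector_derivative_diff dm dU)
    moreover have "k * (cnj A / 3 + gm s (W s)) - k * (cnj B + q * gu s (W s)) = k * (cnj (A / 3 - B) + (gm s (W s) - q * gu s (W s)))"
      by (simp add: algebra_simps)
    moreover have "c * (\<Sum>l\<in>{1..3} - {j}. of_real (\<xi>s l) / (zz j s (W s) - zz l s (W s))) = A / 3 - B"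
    proof -
      have "{1..3} - {3} = {1, 2::nat}" by auto
      then show ?thesis unfolding pi(3)[symmetric] using z z[unfolded One_nat_def] by (simp add: 3 \<xi>c \<xi>c(1)[unfolded One_nat_def] K_def algebra_simps)
    qed
    moreover have "(\<lambda>s. zz 3 s (W s)) = (\<lambda>s. mm s (W s) - of_real (s\<^sup>2) * uh s (W s))"
      by (simp add: zz_def)
    ultimately show ?thesis by (simp only: 3 bg bgs k_def complex_cnj_add)
  qed
qed

lemma yy_has_vector_derivative:
  assumes s: "0 < s" "s < S1" and k: "k \<in> {1..N}"
    and \<xi>s: "\<xi>s 1 = - (1/3) * \<xi>" "\<xi>s 2 = 2/3 * \<xi>" "\<xi>s 3 = 2/3 * \<xi>"
  shows "((\<lambda>s. yy k s (W s)) has_vector_derivative of_real (4 * s ^ 3) * cnj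
     (c * (\<Sum>l\<in>{1..3}. of_real (\<xi>s l) / (yy k s (W s) - zz l s (W s)))
      + c * (\<Sum>h\<in>{1..N} - {k}. of_real (\<zeta> h) / (yy k s (W s) - yy h s (W s))))) (at s)"
proof -
  have \<xi>c: "complex_of_real (\<xi>s 1) = - (of_real \<xi> * (1/3))" "complex_of_real (\<xi>s 2) = of_real \<xi> * (2/3)" "complex_of_real (\<xi>s 3) = of_real \<xi> * (2/3)"
    unfolding \<xi>s by simp_all
  have "(w (k + 4) has_vector_derivative HY k s (W s)) (at s)"
    using w_deriv[OF s, of "k + 4"] k by (simp add: ord_def H_def)
  then have "((\<lambda>s. yy k s (W s)) has_vector_derivative HY k s (W s)) (at s)"
    unfolding yy_def by (auto intro!: derivative_eq_intros)
  moreover have "(\<Sum>l\<in>{1..3}. of_real (\<xi>s l) / (yy k s (W s) - zz l s (W s)))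
      = of_real \<xi> * (1/3 * iz 1 k s (W s) - 2/3 * iz 2 k s (W s) - 2/3 * iz 3 k s (W s))"
  proof -
    have "{1..3} = {1, 2, 3::nat}" by auto
    \<comment> \<open>Reversing the difference flips the signs, which is why the weights -1/3, 2/3,
      2/3 appear negated in \<open>HY\<close>.\<close>
    moreover have "1 / (yy k s (W s) - zz l s (W s)) = - iz l k s (W s)" for l
      unfolding iz_def by (metis minus_diff_eq divide_minus_right)
    then have "x / (yy k s (W s) - zz l s (W s)) = - x * iz l k s (W s)" for x l
      by (metis mult.commute mult_minus_left mult_minus_right times_divide_eq_right mult_1_right)
    ultimately show ?thesis by (simp add: \<xi>c \<xi>c(1)[unfolded One_nat_def] algebra_simps)
  qed
  ultimately show ?thesis by (simp add: HY_def distrib_left)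
qed

end

section \<open>Assembly of the solution\<close>

lemma zz_inj:
  assumes "adm S \<mu> s w"
  shows "inj_on (\<lambda>j. zz j s w) {1..3}"
proof -
  have s: "s > 0" using assms by (simp add: adm_def)
  \<comment> \<open>The moduli alone separate v from u and from - u, as \<bar>v\<bar> >
    \<bar>u\<bar> > 0.\<close>
  have n: "norm (uh s w) < norm (vh s w)" "0 < norm (uh s w)"
    using rh_bounds(3)[OF assms] \<kappa>(1) rh_pos[OF assms] by (simp_all add: norm_uh norm_vh assms)
  moreover have "- uh s w \<noteq> vh s w" using n(1) by (metis norm_minus_cancel less_irrefl)
  ultimately have "uh s w \<noteq> vh s w" "- uh s w \<noteq> vh s w" "uh s w \<noteq> - uh s w" by auto
  note ne = this
  define q where "q = complex_of_real (s\<^sup>2)"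
  have "q \<noteq> 0" using s by (simp add: q_def)
  then have "q * vh s w \<noteq> q * uh s w" "q * vh s w \<noteq> q * (- uh s w)" "q * uh s w \<noteq> q * (- uh s w)"
    using ne by (metis mult_left_cancel)+
  moreover have "{1..3} = {1, 2, 3::nat}" by auto
  ultimately show ?thesis by (auto simp: zz_def simp del: of_real_power simp flip: q_def)
qed

lemma vortex_solution_exists:
  assumes c: "c = 1 / (2 * of_real pi * \<i>)"
    and \<xi>s: "\<xi>s 1 = - (1/3) * \<xi>" "\<xi>s 2 = 2/3 * \<xi>" "\<xi>s 3 = 2/3 * \<xi>"
  shows "\<exists>T>0. \<exists>z y. vortex_solution N \<xi>s \<zeta> T z y \<and>
           (\<forall>j\<in>{1..3}. (z j \<longlongrightarrow> 0) (at_right 0)) \<and>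
           (\<forall>k\<in>{1..N}. (y k \<longlongrightarrow> y0 k) (at_right 0))"
proof -
  have H0: "\<forall>i\<ge>N + 5. \<forall>s w. H i s w = 0" by (simp add: H_def)
  obtain S1 w where S1: "0 < S1" "S1 \<le> S" and sol: "\<forall>i s. norm (w i s) \<le> \<mu>"
      "\<forall>i. (w i \<longlongrightarrow> 0) (at_right 0)"
      "\<forall>i s. 0 < s \<longrightarrow> s < S1 \<longrightarrow>
        ((\<lambda>s. of_real (s ^ ord i) * w i s) has_vector_derivative
           of_real (s ^ ord i) * H i s (\<lambda>j. w j s)) (at s)"
    using singular_system_solution[where H = H and k = ord and n = "N + 5", OF S(1) \<mu> tame_H H0]
    by (elim exE conjE) (rule that)
  note wb = sol(1)[rule_format] and w0 = sol(2)[rule_format] and wd = sol(3)[rule_format]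
  \<comment> \<open>This inverts t = s ^ 4, so the solution lives up to the time
    \<open>S1 ^ 4\<close>.\<close>
  define \<tau> where "\<tau> t = t powr (1/4)" for t :: real
  define z where "z j t = zz j (\<tau> t) (\<lambda>i. w i (\<tau> t))" for j t
  define y where "y k t = yy k (\<tau> t) (\<lambda>i. w i (\<tau> t))" for k t
  have \<tau>: "0 < \<tau> t" "\<tau> t < S1" if "t \<in> {0<..<S1 ^ 4}" for t
  proof -
    show "0 < \<tau> t" using that by (simp add: \<tau>_def)
    have "\<tau> t < (S1 ^ 4) powr (1/4)" unfolding \<tau>_def by (rule powr_less_mono2) (use that in auto)
    also have "(S1 ^ 4) powr (1/4) = S1" 
      using powr_powr[of S1 4 "1/4"] powr_realpow[of S1 4] S1(1) by simp
    finally show "\<tau> t < S1" .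
  qed
  have adm: "adm S \<mu> s (\<lambda>i. w i s)" if "0 < s" "s < S1" for s
    using that S1(2) wb by (simp add: adm_def)
  have a: "adm S \<mu> (\<tau> t) (\<lambda>i. w i (\<tau> t))" if "t \<in> {0<..<S1 ^ 4}" for t
    by (intro adm \<tau> that)
  define vz where "vz j t = c * (\<Sum>l\<in>{1..3} - {j}. of_real (\<xi>s l) / (z j t - z l t))
      + c * (\<Sum>h\<in>{1..N}. of_real (\<zeta> h) / (z j t - y h t))" for j t
  define vy where "vy k t = c * (\<Sum>l\<in>{1..3}. of_real (\<xi>s l) / (y k t - z l t))
      + c * (\<Sum>h\<in>{1..N} - {k}. of_real (\<zeta> h) / (y k t - y h t))" for k t
  have dz: "(z j has_vector_derivative cnj (vz j t)) (at t)" if t: "t \<in> {0<..<S1 ^ 4}" and j: "j \<in> {1..3}" for j t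
    unfolding z_def[abs_def] y_def vz_def \<tau>_def[symmetric]
    using has_vector_derivative_fourth_root[OF _ zz_has_vector_derivative[where w = w, OF S1(2) wb wd \<tau>[OF t] j \<xi>s], of t] t
    by (simp add: \<tau>_def)
  have dy: "(y k has_vector_derivative cnj (vy k t)) (at t)" if t: "t \<in> {0<..<S1 ^ 4}" and k: "k \<in> {1..N}" for k t
    unfolding z_def[abs_def] y_def vy_def \<tau>_def[symmetric]
    using has_vector_derivative_fourth_root[OF _ yy_has_vector_derivative[where w = w, OF S1(2) wb wd \<tau>[OF t] k \<xi>s], of t] t
    by (simp add: \<tau>_def)
  have zi: "inj_on (\<lambda>j. z j t) {1..3}" if "t \<in> {0<..<S1 ^ 4}" for t
    unfolding z_def by (rule zz_inj[OF a[OF that]])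
  have zy: "z j t \<noteq> y k t" if "t \<in> {0<..<S1 ^ 4}" "k \<in> {1..N}" for j k t
    using zz_yy_bound[OF a[OF that(1)] that(2), of j] \<mu> by (auto simp: z_def y_def)
  have yd: "y k t \<noteq> y h t" if "t \<in> {0<..<S1 ^ 4}" "k \<in> {1..N}" "h \<in> {1..N}" "k \<noteq> h" for h k t
    using yy_diff_bound[OF a[OF that(1)] that(2,3,4)] \<mu> by (auto simp: y_def)
  have cz: "continuous_on {0<..<S1 ^ 4} (z j)" if "j \<in> {1..3}" for j
    by (rule continuous_at_imp_continuous_on) (use dz that has_vector_derivative_continuous in blast)
  have cy: "continuous_on {0<..<S1 ^ 4} (y k)" if "k \<in> {1..N}" for k
    by (rule continuous_at_imp_continuous_on) (use dy that has_vector_derivative_continuous in blast)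
  \<comment> \<open>C1 regularity by bootstrapping: differentiable curves are continuous, hence so
    is the right-hand side, whose denominators do not vanish.\<close>
  have "continuous_on {0<..<S1 ^ 4} (\<lambda>t. cnj (vz j t))" if j: "j \<in> {1..3}" for j
  proof -
    have "z j t - z l t \<noteq> 0" if "t \<in> {0<..<S1 ^ 4}" "l \<in> {1..3} - {j}" for t l
      using zi[OF that(1)] j that(2) by (auto simp: inj_on_def)
    then show ?thesis unfolding vz_def using zy j
      by (intro continuous_intros cz cy) auto
  qed
  then have C1z: "z j C1_differentiable_on {0<..<S1 ^ 4}" if "j \<in> {1..3}" for j
    unfolding C1_differentiable_on_def using dz that by (intro exI[of _ "\<lambda>t. cnj (vz j t)"]) simp
  have "continuous_on {0<..<S1 ^ 4} (\<lambda>t. cnj (vy k t))" if k: "k \<in> {1..N}" for k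
  proof -
    have "y k t - z l t \<noteq> 0" if "t \<in> {0<..<S1 ^ 4}" for t l
      using zy[OF that k, of l] by auto
    moreover have "y k t - y h t \<noteq> 0" if "t \<in> {0<..<S1 ^ 4}" "h \<in> {1..N} - {k}" for t h
      using yd[OF that(1) k, of h] that(2) by auto
    ultimately show ?thesis unfolding vy_def using k
      by (intro continuous_intros cz cy) auto
  qed
  then have C1y: "y k C1_differentiable_on {0<..<S1 ^ 4}" if "k \<in> {1..N}" for k
    unfolding C1_differentiable_on_def using dy that by (intro exI[of _ "\<lambda>t. cnj (vy k t)"]) simp
  have "vortex_solution N \<xi>s \<zeta> (S1 ^ 4) z y"
    unfolding vortex_solution_def
  proof (intro conjI ballI)
    fix t assume t: "t \<in> {0<..<S1 ^ 4}"
    show "inj_on (\<lambda>k. y k t) {1..N}" using yd[OF t] by (meson inj_onI)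
    show "((\<lambda>s. cnj (z j s)) has_vector_derivative
              1 / (2 * of_real pi * \<i>) * (\<Sum>l\<in>{1..3} - {j}. of_real (\<xi>s l) / (z j t - z l t))
            + 1 / (2 * of_real pi * \<i>) * (\<Sum>h\<in>{1..N}. of_real (\<zeta> h) / (z j t - y h t))) (at t)"
      if "j \<in> {1..3}" for j
      using has_vector_derivative_cnj[OF dz[OF t that]] unfolding complex_cnj_cnj vz_def c .
    show "((\<lambda>s. cnj (y k s)) has_vector_derivative
              1 / (2 * of_real pi * \<i>) * (\<Sum>l\<in>{1..3}. of_real (\<xi>s l) / (y k t - z l t))
            + 1 / (2 * of_real pi * \<i>) * (\<Sum>h\<in>{1..N} - {k}. of_real (\<zeta> h) / (y k t - y h t))) (at t)"
      if "k \<in> {1..N}" for k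
      using has_vector_derivative_cnj[OF dy[OF t that]] unfolding complex_cnj_cnj vy_def c .
  qed (use C1z C1y zi zy in auto)
  moreover have "(z j \<longlongrightarrow> 0) (at_right 0)" for j
  proof -
    have "((\<lambda>s. zz j s (\<lambda>i. w i s)) \<longlongrightarrow> 0) (at_right 0)"
    proof (rule Lim_null_comparison)
      show "\<forall>\<^sub>F s in at_right 0. norm (zz j s (\<lambda>i. w i s)) \<le> s\<^sup>2 * (3 * sqrt (5 * \<kappa>)) + norm (w 4 s)"
        by (rule eventually_at_rightI[OF _ S1(1)]) (auto intro!: norm_zz_le adm)
      show "((\<lambda>s. s\<^sup>2 * (3 * sqrt (5 * \<kappa>)) + norm (w 4 s)) \<longlongrightarrow> 0) (at_right 0)"
        by (auto intro!: tendsto_eq_intros w0)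
    qed
    from filterlim_compose[OF this filterlim_fourth_root] show ?thesis by (simp add: z_def[abs_def] \<tau>_def)
  qed
  moreover have "(y k \<longlongrightarrow> y0 k) (at_right 0)" for k
  proof -
    have "((\<lambda>s. yy k s (\<lambda>i. w i s)) \<longlongrightarrow> y0 k + 0) (at_right 0)"
      unfolding yy_def by (intro tendsto_intros w0)
    from filterlim_compose[OF this filterlim_fourth_root] show ?thesis by (simp add: y_def[abs_def] \<tau>_def)
  qed
  ultimately show ?thesis using S1(1) by (intro exI[of _ "S1 ^ 4"] conjI exI[of _ z] exI[of _ y]) auto
qed

end

section \<open>Choice of the constants\<close>

lemma separation_constant:
  fixes y0 :: "nat \<Rightarrow> 'a::real_normed_vector"
  assumes "inj_on y0 {1..N}" "\<forall>k\<in>{1..N}. y0 k \<noteq> 0"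
  shows "\<exists>\<mu>>0. (\<forall>k\<in>{1..N}. \<mu> \<le> norm (y0 k)) \<and>
    (\<forall>k\<in>{1..N}. \<forall>h\<in>{1..N}. k \<noteq> h \<longrightarrow> \<mu> \<le> norm (y0 k - y0 h))"
proof -
  define I where "I = {1..N}"
  \<comment> \<open>The diagonal stores the distance from the origin, so that one finite minimum
    covers both kinds of separation.\<close>
  define f where "f = (\<lambda>(k, h). if k = h then norm (y0 k) else norm (y0 k - y0 h))"
  \<comment> \<open>The element 1 keeps the set nonempty when N = 0.\<close>
  define A where "A = insert 1 (f ` (I \<times> I))"
  have fin: "finite A" "A \<noteq> {}" by (simp_all add: A_def I_def)
  have pos: "0 < f (k, h)" if "k \<in> I" "h \<in> I" for k h
    using assms that by (auto simp: f_def I_def inj_on_eq_iff)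
  have le: "Min A \<le> f (k, h)" if "k \<in> I" "h \<in> I" for k h
    by (rule Min_le[OF fin(1)]) (use that in \<open>simp add: A_def\<close>)
  show ?thesis
  proof (intro exI[of _ "Min A"] conjI ballI impI)
    show "0 < Min A" unfolding Min_gr_iff[OF fin] using pos by (auto simp: A_def)
    show "Min A \<le> norm (y0 k)" if "k \<in> {1..N}" for k
      using le[of k k] that by (simp add: f_def I_def)
    show "Min A \<le> norm (y0 k - y0 h)" if "k \<in> {1..N}" "h \<in> {1..N}" "k \<noteq> h" for k h
      using le[of k h] that by (simp add: f_def I_def)
  qed
qed

theorem theorem3p1:
  fixes N :: nat
    and y0 :: "nat \<Rightarrow> complex"
    and \<zeta> :: "nat \<Rightarrow> real"
    and \<xi> :: real
    and \<xi>s :: "nat \<Rightarrow> real"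
  assumes "inj_on y0 {1..N}"
    and "\<forall>k\<in>{1..N}. y0 k \<noteq> 0"
    and "\<xi> \<noteq> 0"
    and "\<xi>s 1 = - (1/3) * \<xi>"
    and "\<xi>s 2 = 2/3 * \<xi>"
    and "\<xi>s 3 = 2/3 * \<xi>"
  shows "\<exists>T>0. \<exists>z y. vortex_solution N \<xi>s \<zeta> T z y \<and>
           (\<forall>j\<in>{1..3}. (z j \<longlongrightarrow> 0) (at_right 0)) \<and>
           (\<forall>k\<in>{1..N}. (y k \<longlongrightarrow> y0 k) (at_right 0))"
proof -
  obtain \<mu> where \<mu>: "0 < \<mu>" "\<forall>k\<in>{1..N}. \<mu> \<le> norm (y0 k)"
    "\<forall>k\<in>{1..N}. \<forall>h\<in>{1..N}. k \<noteq> h \<longrightarrow> \<mu> \<le> norm (y0 k - y0 h)"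
    using separation_constant[OF assms(1,2)] by blast
  \<comment> \<open>For e = - i sgn \<xi> one finds P0 = 3 \<bar>\<xi>\<bar> / (20 pi) * (1 - 3 i
    sgn \<xi>). Its real part 3 \<kappa> / 2 gives this \<kappa>, and its imaginary part - 3
    \<kappa> \<omega> gives \<omega> = 3/2 sgn \<xi>.\<close>
  define \<kappa> where "\<kappa> = \<bar>\<xi>\<bar> / (10 * pi)"
  define c :: complex where "c = 1 / (2 * of_real pi * \<i>)"
  define e :: complex where "e = - \<i> * of_real (sgn \<xi>)"
  define P0 where "P0 = 3 * of_real \<xi> * c * e / (3 * e - 1)"
  \<comment> \<open>The radius used will be \<mu> / 4, since separation by four radii is required;
    the two inner terms are the smallness conditions solved for \<open>S\<close>.\<close>
  define S where "S = min 1 (min (\<kappa> / 2 / (\<mu> / 4)) (\<mu> / 4 / (3 * sqrt (5 * \<kappa>))))"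
  have \<kappa>: "\<kappa> > 0" using assms(3) by (simp add: \<kappa>_def)
  have e: "3 * e \<noteq> 1" by (auto simp: e_def complex_eq_iff)
  have P0: "P0 = of_real (3 * \<kappa> / 2) * (1 - 3 * \<i> * of_real (sgn \<xi>))"
  proof -
    have "3 * of_real \<xi> * c * e = of_real (3 * \<kappa> / 2) * (1 - 3 * \<i> * of_real (sgn \<xi>)) * (3 * e - 1)"
      using assms(3) by (cases "\<xi> > 0") (auto simp: c_def e_def \<kappa>_def complex_eq_iff field_simps)
    then show ?thesis using e by (simp add: P0_def field_simps)
  qed
  have "vortex_burst N y0 \<xi> c e (csqrt e) P0 \<kappa> (3/2 * sgn \<xi>) (\<mu> / 4) S"
  proof
    show "norm (csqrt e) = 1" using assms(3) by (simp add: e_def norm_mult)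
    show "S * (\<mu> / 4) \<le> \<kappa> / 2" "S * (3 * sqrt (5 * \<kappa>)) \<le> \<mu> / 4"
    proof -
      have "S \<le> \<kappa> / 2 / (\<mu> / 4)" "S \<le> \<mu> / 4 / (3 * sqrt (5 * \<kappa>))" by (simp_all add: S_def)
      then show "S * (\<mu> / 4) \<le> \<kappa> / 2" "S * (3 * sqrt (5 * \<kappa>)) \<le> \<mu> / 4"
        using \<mu>(1) \<kappa> by (simp_all add: pos_le_divide_eq)
    qed
    show "0 < S" "S \<le> 1" using \<mu>(1) \<kappa> by (auto simp: S_def)
    show "P0 = 3 * of_real \<xi> * c * e / (3 * e - 1)" by (rule P0_def)
    show "Re P0 = 3 * \<kappa> / 2" "Im P0 = - 3 * \<kappa> * (3/2 * sgn \<xi>)" by (simp_all add: P0)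
  qed (use \<mu> \<kappa> e in auto)
  then show ?thesis
    by (rule vortex_burst.vortex_solution_exists) (use assms c_def in auto)
qed

end
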